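(* There exists an LCL problem $\Pi$ (on graphs of bounded maximum degree) that can be solved by a deterministic LOCAL algorithm in $O(\log n)$ rounds, but for which every CONGEST algorithm, even randomized, requires $\Omega(\sqrt{n} / \log^2 n)$ rounds.
   Context: An LCL (locally checkable labeling) problem is a tuple $\Pi=(\Sigma_{\mathrm{in}},\Sigma_{\mathrm{out}},C,r)$ where $\Sigma_{\mathrm{in}},\Sigma_{\mathrm{out}}$ are finite label sets, $r$ is a constant (checkability radius), and $C$ is a finite set of pairs $(H,v)$ where $H$ is a graph, $v$ a node of $H$ of radius at most $r$ in $H$, and every node-edge pair (half-edge) of $H$ carries a label from $\Sigma_{\mathrm{in}}$ and one from $\Sigma_{\mathrm{out}}$; input graphs have maximum degree bounded by a constant $\Delta$. Solving $\Pi$: for any input labeling of the half-edges, assign output labels so that the labeled radius-$r$ ball around every node is isomorphic to a labeled graph in $C$. LOCAL model: the connected $n$-node input graph is the network; synchronous rounds with arbitrarily large messages. CONGEST model: same with $O(\log n)$-bit messages. Deterministic algorithms have unique IDs of $O(\log n)$ bits; randomized algorithms are Monte Carlo and must succeed with high probability. *)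

theory Defs
  imports "HOL-Probability.Probability_Mass_Function" "HOL-Library.Landau_Symbols"
begin

text \<open>Vertices are natural numbers; a vertex's name is its unique identifier.
  A graph is a vertex set V together with an adjacency relation E.
  A half-edge is an ordered pair (v,u) with E v u; labelings of half-edges are
  functions nat => nat => nat (only values on half-edges matter).\<close>

fun reach_le :: "(nat \<Rightarrow> nat \<Rightarrow> bool) \<Rightarrow> nat \<Rightarrow> nat \<Rightarrow> nat \<Rightarrow> bool" where
  "reach_le E 0 u w = (u = w)"
| "reach_le E (Suc k) u w = (u = w \<or> (\<exists>x. E u x \<and> reach_le E k x w))"

definition simple_graph :: "nat set \<Rightarrow> (nat \<Rightarrow> nat \<Rightarrow> bool) \<Rightarrow> bool" where
  "simple_graph V E \<longleftrightarrow> finite V \<and> (\<forall>u w. E u w \<longrightarrow> u \<in> V \<and> w \<in> V \<and> u \<noteq> w \<and> E w u)"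

definition connected_graph :: "nat set \<Rightarrow> (nat \<Rightarrow> nat \<Rightarrow> bool) \<Rightarrow> bool" where
  "connected_graph V E \<longleftrightarrow> (\<forall>u\<in>V. \<forall>w\<in>V. \<exists>k. reach_le E k u w)"

definition max_degree_le :: "nat set \<Rightarrow> (nat \<Rightarrow> nat \<Rightarrow> bool) \<Rightarrow> nat \<Rightarrow> bool" where
  "max_degree_le V E \<Delta> \<longleftrightarrow> (\<forall>v\<in>V. card {u. E v u} \<le> \<Delta>)"

datatype lgraph = LG (lg_V: "nat set") (lg_E: "nat \<Rightarrow> nat \<Rightarrow> bool")
  (lg_in: "nat \<Rightarrow> nat \<Rightarrow> nat") (lg_out: "nat \<Rightarrow> nat \<Rightarrow> nat") (lg_c: nat)

definition lg_iso :: "lgraph \<Rightarrow> lgraph \<Rightarrow> bool" where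
  "lg_iso H1 H2 \<longleftrightarrow> (\<exists>f. bij_betw f (lg_V H1) (lg_V H2) \<and> f (lg_c H1) = lg_c H2 \<and>
     (\<forall>u\<in>lg_V H1. \<forall>w\<in>lg_V H1.
        (lg_E H1 u w \<longleftrightarrow> lg_E H2 (f u) (f w)) \<and>
        (lg_E H1 u w \<longrightarrow> lg_in H1 u w = lg_in H2 (f u) (f w)
                        \<and> lg_out H1 u w = lg_out H2 (f u) (f w))))"

definition ball :: "(nat \<Rightarrow> nat \<Rightarrow> bool) \<Rightarrow> (nat \<Rightarrow> nat \<Rightarrow> nat) \<Rightarrow> (nat \<Rightarrow> nat \<Rightarrow> nat)
                     \<Rightarrow> nat \<Rightarrow> nat \<Rightarrow> lgraph" where
  "ball E lin lout r v =
     (let B = {w. reach_le E r v w} in LG B (\<lambda>a b. E a b \<and> a \<in> B \<and> b \<in> B) lin lout v)"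

type_synonym lcl = "nat set \<times> nat set \<times> lgraph set \<times> nat"

definition lcl_Sin :: "lcl \<Rightarrow> nat set" where "lcl_Sin P = fst P"
definition lcl_Sout :: "lcl \<Rightarrow> nat set" where "lcl_Sout P = fst (snd P)"
definition lcl_C :: "lcl \<Rightarrow> lgraph set" where "lcl_C P = fst (snd (snd P))"
definition lcl_r :: "lcl \<Rightarrow> nat" where "lcl_r P = snd (snd (snd P))"

definition is_lcl :: "lcl \<Rightarrow> bool" where
  "is_lcl P \<longleftrightarrow> finite (lcl_Sin P) \<and> finite (lcl_Sout P) \<and> finite (lcl_C P) \<and>
     (\<forall>H\<in>lcl_C P. simple_graph (lg_V H) (lg_E H) \<and> lg_c H \<in> lg_V H \<and>
        (\<forall>w\<in>lg_V H. reach_le (lg_E H) (lcl_r P) (lg_c H) w) \<and>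
        (\<forall>u w. lg_E H u w \<longrightarrow> lg_in H u w \<in> lcl_Sin P \<and> lg_out H u w \<in> lcl_Sout P))"

definition lcl_instance :: "lcl \<Rightarrow> nat \<Rightarrow> nat \<Rightarrow> nat \<Rightarrow> nat set \<Rightarrow> (nat \<Rightarrow> nat \<Rightarrow> bool)
                              \<Rightarrow> (nat \<Rightarrow> nat \<Rightarrow> nat) \<Rightarrow> bool" where
  "lcl_instance P \<Delta> c n V E lin \<longleftrightarrow>
     simple_graph V E \<and> connected_graph V E \<and> max_degree_le V E \<Delta> \<and>
     card V = n \<and> V \<subseteq> {..<n ^ c} \<and>
     (\<forall>u w. E u w \<longrightarrow> lin u w \<in> lcl_Sin P)"

definition lcl_valid :: "lcl \<Rightarrow> nat set \<Rightarrow> (nat \<Rightarrow> nat \<Rightarrow> bool) \<Rightarrow> (nat \<Rightarrow> nat \<Rightarrow> nat)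
                           \<Rightarrow> (nat \<Rightarrow> nat \<Rightarrow> nat) \<Rightarrow> bool" where
  "lcl_valid P V E lin lout \<longleftrightarrow>
     (\<forall>u w. E u w \<longrightarrow> lout u w \<in> lcl_Sout P) \<and>
     (\<forall>v\<in>V. \<exists>H\<in>lcl_C P. lg_iso (ball E lin lout (lcl_r P) v) H)"

text \<open>A distributed algorithm, with states and messages encoded as bit strings.
  Every component takes n (the number of nodes, known to all nodes).
  init n v ins rho: initial state of node v (its identifier), where ins maps each
    neighbour identifier u to the input label of the half-edge (v,u), and rho is
    the node's private random bit string (of length bits n);
  send n s u: message sent by a node in state s to its neighbour u;
  recv n s msgs: new state after receiving msgs (neighbour identifier -> message);
  out n s u: output label of the half-edge towards neighbour u.\<close>
datatype alg = Alg
  (a_init: "nat \<Rightarrow> nat \<Rightarrow> (nat \<Rightarrow> nat option) \<Rightarrow> bool list \<Rightarrow> bool list")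
  (a_send: "nat \<Rightarrow> bool list \<Rightarrow> nat \<Rightarrow> bool list")
  (a_recv: "nat \<Rightarrow> bool list \<Rightarrow> (nat \<Rightarrow> bool list option) \<Rightarrow> bool list")
  (a_out: "nat \<Rightarrow> bool list \<Rightarrow> nat \<Rightarrow> nat")
  (a_bits: "nat \<Rightarrow> nat")

primrec run :: "alg \<Rightarrow> nat \<Rightarrow> (nat \<Rightarrow> nat \<Rightarrow> bool) \<Rightarrow> (nat \<Rightarrow> nat \<Rightarrow> nat)
                  \<Rightarrow> (nat \<Rightarrow> bool list) \<Rightarrow> nat \<Rightarrow> nat \<Rightarrow> bool list" where
  "run A n E lin \<rho> 0 = (\<lambda>v. a_init A n v (\<lambda>u. if E v u then Some (lin v u) else None) (\<rho> v))"
| "run A n E lin \<rho> (Suc t) = (\<lambda>v. a_recv A n (run A n E lin \<rho> t v)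
        (\<lambda>u. if E v u then Some (a_send A n (run A n E lin \<rho> t u) v) else None))"

definition alg_output :: "alg \<Rightarrow> nat \<Rightarrow> (nat \<Rightarrow> nat \<Rightarrow> bool) \<Rightarrow> (nat \<Rightarrow> nat \<Rightarrow> nat)
                            \<Rightarrow> (nat \<Rightarrow> bool list) \<Rightarrow> nat \<Rightarrow> nat \<Rightarrow> nat \<Rightarrow> nat" where
  "alg_output A n E lin \<rho> T = (\<lambda>v u. a_out A n (run A n E lin \<rho> T v) u)"

definition rand_bits :: "nat set \<Rightarrow> nat \<Rightarrow> (nat \<Rightarrow> bool list) pmf" where
  "rand_bits V L = pmf_of_set (PiE V (\<lambda>_. {xs. length xs = L}))"

definition congest_alg :: "nat \<Rightarrow> alg \<Rightarrow> bool" where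
  "congest_alg \<beta> A \<longleftrightarrow>
     (\<forall>n s u. length (a_send A n s u) \<le> \<beta> * (nat \<lceil>log 2 (real n)\<rceil> + 1))"

definition det_solves :: "lcl \<Rightarrow> nat \<Rightarrow> nat \<Rightarrow> alg \<Rightarrow> (nat \<Rightarrow> nat) \<Rightarrow> bool" where
  "det_solves P \<Delta> c A T \<longleftrightarrow> (\<forall>n. a_bits A n = 0) \<and>
     (\<forall>n V E lin. lcl_instance P \<Delta> c n V E lin \<longrightarrow>
        lcl_valid P V E lin (alg_output A n E lin (\<lambda>_. []) (T n)))"

definition rand_solves :: "lcl \<Rightarrow> nat \<Rightarrow> nat \<Rightarrow> alg \<Rightarrow> (nat \<Rightarrow> nat) \<Rightarrow> bool" where
  "rand_solves P \<Delta> c A T \<longleftrightarrow>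
     (\<forall>n V E lin. lcl_instance P \<Delta> c n V E lin \<longrightarrow>
        measure_pmf.prob (rand_bits V (a_bits A n))
          {\<rho>. lcl_valid P V E lin (alg_output A n E lin \<rho> (T n))} \<ge> 1 - 1 / real n)"

end

theory Submission
  imports Defs "HOL-Library.Discrete_Functions" "HOL-Library.Log_Nat"
begin

text \<open>The hard graphs are Das Sarma style grids: about \<open>\<surd>n\<close> rows of length about \<open>\<surd>n\<close>,
  each column carrying a perfect binary tree, and a further perfect binary tree over the column
  roots. Every row has to copy the input bit found at its left end. The trees give diameter
  \<open>O(log n)\<close>, so LOCAL algorithms can read the bits directly. In CONGEST, within fewer than \<open>\<surd>n\<close> rounds
  the \<open>\<surd>n\<close> bits can reach the right ends only through the \<open>O(log n)\<close> tree edges crossing a cut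
  that moves right by one column per round.

  To make the problem an LCL, it has to be easy on every labelled graph, so a node may instead
  point to a local defect, going first up and then down the tree. Local rules force a defect-free
  tree to be perfect: siblings are laterally adjacent, and laterally adjacent nodes agree on being
  leaves, have equal or laterally adjacent parents, and have laterally adjacent children.
  Hence, if no defect is seen within distance \<open>O(log n)\<close>, the whole component is defect-free
  and lies within that distance. On a genuine grid all pointers are impossible, since upward
  chains end at the root and downward chains at the leaves.\<close>

section \<open>The labelling problem\<close>

text \<open>The two factors log n in the lower bound are the number of tree edges crossing the cut
  in a round, two for each of \<open>s\<close> levels, and the message length. Randomness is treated
  by counting: for fixed random strings the messages across the cut determine all the bits, so at
  most as many bit vectors are solved as there are transcripts, while on average over the strings at
  least half of all vectors must be solved. For the upper bound the labelled graph is arbitrary: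
  parents may form cycles, rows may close up, and a row may be far longer than the search radius.
  Counting replaces acyclicity: the levels of a defect-free tree double, so on fewer than 2^M nodes
  no tree free of defects has depth M, and a climb that sees no defect must end at a root within
  fewer than M steps. The row of a node then stays inside that shallow tree, however long it
  is.\<close>

text \<open>Input labels of half-edges: 0 to the parent, 1 to a child, 2 to a lateral neighbour,
  3 and 4 to the successor in the row (4 encodes the bit 1 at the start of a row), 5 to the
  predecessor in the row, 6 for padding edges, which are ignored. Rows are lateral too.\<close>

definition port ::
  "(nat \<Rightarrow> nat \<Rightarrow> bool) \<Rightarrow> (nat \<Rightarrow> nat \<Rightarrow> nat) \<Rightarrow> nat set \<Rightarrow> nat \<Rightarrow> nat set" where
  "port E lin L x = {y. E x y \<and> lin x y \<in> L}"

abbreviation "par E lin \<equiv> port E lin {0}"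
abbreviation "chi E lin \<equiv> port E lin {1}"
abbreviation "lat E lin \<equiv> port E lin {2,3,4,5}"
abbreviation "nxt E lin \<equiv> port E lin {3,4}"
abbreviation "prv E lin \<equiv> port E lin {5}"

text \<open>The head of a row edge carries 5 whether its tail carries 3 or 4, so an input bit is
  visible only at the tail.\<close>

definition port_pairs :: "(nat \<times> nat) set" where
  "port_pairs = {(0,1),(1,0),(2,2),(3,5),(4,5),(5,3),(5,4),(6,6)}"

text \<open>All conditions read half-edges that leave \<open>v\<close> or a neighbour of
  \<open>v\<close>, hence checkability radius 2. A lateral neighbour forces a parent, so a
  defect-free root has no lateral neighbours; this anchors the later inductions over levels.\<close>

definition node_ok :: "(nat \<Rightarrow> nat \<Rightarrow> bool) \<Rightarrow> (nat \<Rightarrow> nat \<Rightarrow> nat) \<Rightarrow> nat \<Rightarrow> bool" where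
  "node_ok E lin v \<longleftrightarrow>
     (\<forall>y\<in>{y. E v y}. (lin v y, lin y v) \<in> port_pairs) \<and>
     (\<forall>y\<in>par E lin v. \<forall>z\<in>par E lin v. y = z) \<and>
     (\<forall>y\<in>nxt E lin v. \<forall>z\<in>nxt E lin v. y = z) \<and>
     (\<forall>y\<in>prv E lin v. \<forall>z\<in>prv E lin v. y = z) \<and>
     (\<forall>y\<in>chi E lin v. \<exists>z\<in>chi E lin v. z \<noteq> y \<and> z \<in> lat E lin y \<and>
        (\<forall>u\<in>chi E lin v. u = y \<or> u = z)) \<and>
     (\<forall>z\<in>lat E lin v. (\<exists>p\<in>par E lin v. \<exists>q\<in>par E lin z. p = q \<or> q \<in> lat E lin p) \<and>
        (chi E lin v = {} \<longleftrightarrow> chi E lin z = {}) \<and>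
        (chi E lin v \<noteq> {} \<longrightarrow> (\<exists>y\<in>chi E lin v. \<exists>y'\<in>chi E lin z. y' \<in> lat E lin y)))"

text \<open>Output labels: 0 and 1 are bits, 2 claims a defect at the node, 3 one below it, and 4 one
  below some ancestor.\<close>

definition loc_valid :: "(nat \<Rightarrow> nat \<Rightarrow> bool) \<Rightarrow> (nat \<Rightarrow> nat \<Rightarrow> nat) \<Rightarrow> (nat \<Rightarrow> nat \<Rightarrow> nat)
    \<Rightarrow> nat \<Rightarrow> bool" where
  "loc_valid E lin lout v \<longleftrightarrow> (\<exists>a\<le>4.
     (\<forall>u\<in>{u. E v u}. lout v u = a) \<and>
     (a = 2 \<longrightarrow> \<not> node_ok E lin v) \<and>
     (a = 3 \<longrightarrow> (\<exists>u\<in>chi E lin v. lout u v \<in> {2,3})) \<and>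
     (a = 4 \<longrightarrow> (\<exists>u\<in>par E lin v. lout u v \<in> {2,3,4})) \<and>
     (a \<le> 1 \<longrightarrow> (\<forall>u\<in>nxt E lin v. lout u v = a \<or> 2 \<le> lout u v) \<and>
        (prv E lin v = {} \<longrightarrow> (\<forall>u\<in>nxt E lin v. lin v u = 3 + a))))"

text \<open>The label of a node exists only as the common value on its half-edges, so any one
  neighbour \<open>w\<close> serves to read it off.\<close>

lemma loc_validD:
  assumes loc: "loc_valid E lin lout v" and w: "E v w"
  shows "lout v w \<le> 4"
    and "E v u \<Longrightarrow> lout v u = lout v w"
    and "lout v w = 2 \<Longrightarrow> \<not> node_ok E lin v"
    and "lout v w = 3 \<Longrightarrow> \<exists>u\<in>chi E lin v. lout u v \<in> {2,3}"
    and "lout v w = 4 \<Longrightarrow> \<exists>u\<in>par E lin v. lout u v \<in> {2,3,4}"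
    and "lout v w \<le> 1 \<Longrightarrow> u \<in> nxt E lin v \<Longrightarrow> lout u v = lout v w \<or> 2 \<le> lout u v"
    and "lout v w \<le> 1 \<Longrightarrow> prv E lin v = {} \<Longrightarrow> u \<in> nxt E lin v \<Longrightarrow> lin v u = 3 + lout v w"
proof -
  obtain b where b: "b \<le> 4" "\<forall>u\<in>{u. E v u}. lout v u = b" "b = 2 \<longrightarrow> \<not> node_ok E lin v"
    "b = 3 \<longrightarrow> (\<exists>u\<in>chi E lin v. lout u v \<in> {2,3})"
    "b = 4 \<longrightarrow> (\<exists>u\<in>par E lin v. lout u v \<in> {2,3,4})"
    "b \<le> 1 \<longrightarrow> (\<forall>u\<in>nxt E lin v. lout u v = b \<or> 2 \<le> lout u v) \<and>
        (prv E lin v = {} \<longrightarrow> (\<forall>u\<in>nxt E lin v. lin v u = 3 + b))"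
    using loc unfolding loc_valid_def by (elim exE conjE)
  have eq: "lout v u = b" if "E v u" for u using b(2) that by simp
  show "E v u \<Longrightarrow> lout v u = lout v w" using eq w by simp
  show "lout v w \<le> 4"
    and "lout v w = 2 \<Longrightarrow> \<not> node_ok E lin v"
    and "lout v w = 3 \<Longrightarrow> \<exists>u\<in>chi E lin v. lout u v \<in> {2,3}"
    and "lout v w = 4 \<Longrightarrow> \<exists>u\<in>par E lin v. lout u v \<in> {2,3,4}"
    and "lout v w \<le> 1 \<Longrightarrow> u \<in> nxt E lin v \<Longrightarrow> lout u v = lout v w \<or> 2 \<le> lout u v"
    and "lout v w \<le> 1 \<Longrightarrow> prv E lin v = {} \<Longrightarrow> u \<in> nxt E lin v \<Longrightarrow> lin v u = 3 + lout v w"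
    unfolding eq[OF w] using b(1,3-) by simp_all
qed

section \<open>Invariance of the local rules under maps of neighbourhoods\<close>

lemma port_image:
  assumes "{z. E' (f x) z} = f ` {y. E x y}"
    and "\<And>y. E x y \<Longrightarrow> lin' (f x) (f y) = lin x y"
  shows "port E' lin' L (f x) = f ` port E lin L x"
proof -
  have "z \<in> port E' lin' L (f x) \<longleftrightarrow> z \<in> {z. E' (f x) z} \<and> lin' (f x) z \<in> L" for z
    by (simp add: port_def)
  also have "\<dots> z \<longleftrightarrow> z \<in> f ` port E lin L x" for z
    unfolding assms(1) using assms(2) by (auto simp: port_def)
  finally show ?thesis by blast
qed

lemma port_nbr: "y \<in> port E lin L x \<Longrightarrow> E x y"
  by (simp add: port_def)

text \<open>The interface covers both an isomorphism of radius-2 balls and the identity between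
  graphs that agree near \<open>v\<close>. Only edges leaving the closed neighbourhood
  \<open>N\<close> are matched, the rules at \<open>v\<close> reading no others; \<open>B\<close>
  contains their ends, so that \<open>f\<close> keeps these apart.\<close>

locale neighbourhood_map =
  fixes f :: "nat \<Rightarrow> nat" and B N :: "nat set" and v :: nat
    and E E' :: "nat \<Rightarrow> nat \<Rightarrow> bool" and lin lin' :: "nat \<Rightarrow> nat \<Rightarrow> nat"
  assumes inj: "inj_on f B"
    and N_def: "N = insert v {y. E v y}"
    and NB: "N \<subseteq> B"
    and nbr_B: "\<And>x y. x \<in> N \<Longrightarrow> E x y \<Longrightarrow> y \<in> B"
    and sym: "\<And>y. E v y \<Longrightarrow> E y v"
    and nbr_image: "\<And>x. x \<in> N \<Longrightarrow> {z. E' (f x) z} = f ` {y. E x y}"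
    and lin_eq: "\<And>x y. x \<in> N \<Longrightarrow> E x y \<Longrightarrow> lin' (f x) (f y) = lin x y"
begin

lemma port_eq: "x \<in> N \<Longrightarrow> port E' lin' L (f x) = f ` port E lin L x"
  using nbr_image lin_eq by (intro port_image) auto

lemma eq_iff: "x \<in> B \<Longrightarrow> y \<in> B \<Longrightarrow> f x = f y \<longleftrightarrow> x = y"
  using inj by (auto dest: inj_onD)

lemma mem_port: "x \<in> N \<Longrightarrow> y \<in> B \<Longrightarrow> f y \<in> port E' lin' L (f x) \<longleftrightarrow> y \<in> port E lin L x"
proof -
  assume x: "x \<in> N" and y: "y \<in> B"
  have "port E lin L x \<subseteq> B" using nbr_B[OF x] by (auto simp: port_def)
  then show ?thesis
    using inj_on_image_mem_iff[OF inj y] by (simp add: port_eq[OF x])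
qed

lemma v_N: "v \<in> N" and nbr_N: "E v y \<Longrightarrow> y \<in> N" and port_N: "y \<in> port E lin L v \<Longrightarrow> y \<in> N"
  by (auto simp: N_def port_def)

lemma in_B: "x \<in> N \<Longrightarrow> x \<in> B" and port_B: "x \<in> N \<Longrightarrow> y \<in> port E lin L x \<Longrightarrow> y \<in> B"
  using NB nbr_B by (auto simp: port_def)

lemma node_ok_iff: "node_ok E' lin' (f v) \<longleftrightarrow> node_ok E lin v"
proof -
  have pairing: "(\<forall>y\<in>{y. E' (f v) y}. (lin' (f v) y, lin' y (f v)) \<in> S) \<longleftrightarrow>
      (\<forall>y\<in>{y. E v y}. (lin v y, lin y v) \<in> S)" for S
    unfolding nbr_image[OF v_N] using lin_eq v_N nbr_N sym by simp
  have uniq: "(\<forall>y\<in>port E' lin' L (f v). \<forall>z\<in>port E' lin' L (f v). y = z) \<longleftrightarrow>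
      (\<forall>y\<in>port E lin L v. \<forall>z\<in>port E lin L v. y = z)" for L
    unfolding port_eq[OF v_N] using eq_iff port_B[OF v_N] by simp
  have children: "(\<forall>y\<in>chi E' lin' (f v). \<exists>z\<in>chi E' lin' (f v). z \<noteq> y \<and> z \<in> lat E' lin' y \<and>
        (\<forall>u\<in>chi E' lin' (f v). u = y \<or> u = z)) \<longleftrightarrow>
     (\<forall>y\<in>chi E lin v. \<exists>z\<in>chi E lin v. z \<noteq> y \<and> z \<in> lat E lin y \<and>
        (\<forall>u\<in>chi E lin v. u = y \<or> u = z))"
    unfolding port_eq[OF v_N] ball_simps bex_simps image_iff
    using mem_port port_N in_B by (auto simp: eq_iff)
  have lateral: "((\<exists>p\<in>par E' lin' (f v). \<exists>q\<in>par E' lin' (f z). p = q \<or> q \<in> lat E' lin' p) \<and>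
        (chi E' lin' (f v) = {} \<longleftrightarrow> chi E' lin' (f z) = {}) \<and>
        (chi E' lin' (f v) \<noteq> {} \<longrightarrow>
          (\<exists>y\<in>chi E' lin' (f v). \<exists>y'\<in>chi E' lin' (f z). y' \<in> lat E' lin' y))) \<longleftrightarrow>
      ((\<exists>p\<in>par E lin v. \<exists>q\<in>par E lin z. p = q \<or> q \<in> lat E lin p) \<and>
        (chi E lin v = {} \<longleftrightarrow> chi E lin z = {}) \<and>
        (chi E lin v \<noteq> {} \<longrightarrow> (\<exists>y\<in>chi E lin v. \<exists>y'\<in>chi E lin z. y' \<in> lat E lin y)))"
    if z: "z \<in> lat E lin v" for z
  proof -
    have zN: "z \<in> N" using z by (rule port_N)
    have 1: "(\<exists>p\<in>par E' lin' (f v). \<exists>q\<in>par E' lin' (f z). p = q \<or> q \<in> lat E' lin' p) \<longleftrightarrow>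
       (\<exists>p\<in>par E lin v. \<exists>q\<in>par E lin z. p = q \<or> q \<in> lat E lin p)"
      unfolding port_eq[OF v_N, of "{0}"] port_eq[OF zN, of "{0}"] ball_simps bex_simps
      by (intro bex_cong refl) (simp add: eq_iff mem_port port_N in_B port_B[OF zN])
    have 2: "(\<exists>y\<in>chi E' lin' (f v). \<exists>y'\<in>chi E' lin' (f z). y' \<in> lat E' lin' y) \<longleftrightarrow>
      (\<exists>y\<in>chi E lin v. \<exists>y'\<in>chi E lin z. y' \<in> lat E lin y)"
      unfolding port_eq[OF v_N, of "{1}"] port_eq[OF zN, of "{1}"] ball_simps bex_simps
      by (intro bex_cong refl) (simp add: mem_port port_N port_B[OF zN])
    show ?thesis unfolding 1 2 by (simp add: port_eq v_N zN)
  qed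
  show ?thesis
    unfolding node_ok_def pairing uniq children port_eq[OF v_N, of "{2,3,4,5}"] ball_simps
    by (intro arg_cong2[of _ _ _ _ conj] pairing[unfolded Ball_Collect[symmetric] ball_simps] refl ball_cong lateral)
qed

lemma loc_valid_iff:
  assumes lout_eq: "\<And>x y. x \<in> N \<Longrightarrow> E x y \<Longrightarrow> lout' (f x) (f y) = lout x y"
  shows "loc_valid E' lin' lout' (f v) \<longleftrightarrow> loc_valid E lin lout v"
proof -
  have out: "lout' (f u) (f v) = lout u v" if "u \<in> port E lin L v" for u L
    using lout_eq[OF port_N[OF that]] sym that by (simp add: port_def)
  have lin: "lin' (f v) (f u) = lin v u" if "u \<in> port E lin L v" for u L
    using lin_eq[OF v_N] that by (simp add: port_def)
  have "(\<forall>u\<in>{u. E' (f v) u}. lout' (f v) u = a) \<longleftrightarrow> (\<forall>u\<in>{u. E v u}. lout v u = a)" for a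
    unfolding nbr_image[OF v_N] using lout_eq[OF v_N] by simp
  then have 1: "(\<forall>u. E' (f v) u \<longrightarrow> lout' (f v) u = a) \<longleftrightarrow> (\<forall>u. E v u \<longrightarrow> lout v u = a)" for a
    by simp
  show ?thesis
    unfolding loc_valid_def Ball_Collect[symmetric] ball_simps 1 node_ok_iff port_eq[OF v_N] ball_simps bex_simps image_is_empty
    by (simp add: out lin cong: bex_cong ball_cong)
qed

end

text \<open>A ball of radius 2 in a graph of maximum degree 7 has at most 1 + 7 + 49 = 57 nodes.\<close>

definition shortcut_configs :: "lgraph set" where
  "shortcut_configs = {H. lg_V H \<subseteq> {..<57} \<and> simple_graph (lg_V H) (lg_E H) \<and> lg_c H \<in> lg_V H \<and>
     (\<forall>w\<in>lg_V H. reach_le (lg_E H) 2 (lg_c H) w) \<and>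
     (\<forall>u w. lg_E H u w \<longrightarrow> lg_in H u w \<in> {..6} \<and> lg_out H u w \<in> {..4}) \<and>
     (\<forall>u w. \<not> lg_E H u w \<longrightarrow> lg_in H u w = 0 \<and> lg_out H u w = 0) \<and>
     loc_valid (lg_E H) (lg_in H) (lg_out H) (lg_c H)}"

definition shortcut_lcl :: lcl where
  "shortcut_lcl = ({..6}, {..4}, shortcut_configs, 2)"

lemma shortcut_lcl_simps [simp]:
  "lcl_Sin shortcut_lcl = {..6}" "lcl_Sout shortcut_lcl = {..4}"
  "lcl_C shortcut_lcl = shortcut_configs" "lcl_r shortcut_lcl = 2"
  by (simp_all add: shortcut_lcl_def lcl_Sin_def lcl_Sout_def lcl_C_def lcl_r_def)

section \<open>Finiteness of the set of configurations\<close>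

definition supported_on :: "nat set \<Rightarrow> 'b set \<Rightarrow> 'b \<Rightarrow> (nat \<Rightarrow> nat \<Rightarrow> 'b) set" where
  "supported_on A B d =
     {g. \<forall>u w. (u \<in> A \<and> w \<in> A \<longrightarrow> g u w \<in> B) \<and> (\<not> (u \<in> A \<and> w \<in> A) \<longrightarrow> g u w = d)}"

lemma finite_supported_on:
  assumes "finite A" "finite B"
  shows "finite (supported_on A B d)"
proof -
  have "finite {h. \<forall>p. (p \<in> A \<times> A \<longrightarrow> h p \<in> B) \<and> (p \<notin> A \<times> A \<longrightarrow> h p = d)}" (is "finite ?T")
    using assms finite_set_of_finite_funs[of "A \<times> A" B d] by simp
  moreover have "supported_on A B d \<subseteq> curry ` ?T"
  proof
    fix g assume "g \<in> supported_on A B d"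
    then have "case_prod g \<in> ?T" by (simp add: supported_on_def)
    then show "g \<in> curry ` ?T" by (rule image_eqI[rotated]) simp
  qed
  ultimately show ?thesis by (meson finite_imageI finite_subset)
qed

text \<open>The default label 0 off the edges is what gives finiteness: otherwise every
  configuration would have infinitely many copies differing in irrelevant values.\<close>

lemma finite_shortcut_configs: "finite shortcut_configs"
proof -
  let ?A = "{..<57::nat}"
  let ?X = "(\<lambda>(V, E, i, o', c). LG V E i o' c) ` (Pow ?A \<times> supported_on ?A UNIV False \<times>
    supported_on ?A {..6} 0 \<times> supported_on ?A {..4} 0 \<times> ?A)"
  have "finite ?X"
    by (intro finite_imageI finite_cartesian_product finite_supported_on) auto
  moreover have "shortcut_configs \<subseteq> ?X"
  proof
    fix H assume H: "H \<in> shortcut_configs"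
    have sub: "lg_V H \<subseteq> ?A" and E: "lg_E H u w \<Longrightarrow> u \<in> ?A \<and> w \<in> ?A" for u w
      using H by (auto simp: shortcut_configs_def simple_graph_def)
    have lin: "lg_in H u w \<in> (if lg_E H u w then {..6} else {0})"
      and lout: "lg_out H u w \<in> (if lg_E H u w then {..4} else {0})" for u w
      using H by (simp_all add: shortcut_configs_def)
    have "lg_E H \<in> supported_on ?A UNIV False"
      unfolding supported_on_def using E by blast
    moreover have "lg_in H \<in> supported_on ?A {..6} 0"
    proof -
      have "lg_in H u w \<in> {..6} \<and> (\<not> (u \<in> ?A \<and> w \<in> ?A) \<longrightarrow> lg_in H u w = 0)" for u w
        using lin[of u w] E[of u w] by (cases "lg_E H u w") auto
      then show ?thesis unfolding supported_on_def by blast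
    qed
    moreover have "lg_out H \<in> supported_on ?A {..4} 0"
    proof -
      have "lg_out H u w \<in> {..4} \<and> (\<not> (u \<in> ?A \<and> w \<in> ?A) \<longrightarrow> lg_out H u w = 0)" for u w
        using lout[of u w] E[of u w] by (cases "lg_E H u w") auto
      then show ?thesis unfolding supported_on_def by blast
    qed
    moreover have "lg_c H \<in> ?A" using H sub by (auto simp: shortcut_configs_def)
    moreover have "H = (\<lambda>(V, E, i, o', c). LG V E i o' c)
        (lg_V H, lg_E H, lg_in H, lg_out H, lg_c H)"
      by simp
    ultimately show "H \<in> ?X"
      using sub by (intro image_eqI) (auto simp only: mem_Times_iff fst_conv snd_conv Pow_iff)
  qed
  ultimately show ?thesis by (rule finite_subset[rotated])
qed

lemma is_lcl_shortcut: "is_lcl shortcut_lcl"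
  using finite_shortcut_configs by (auto simp: is_lcl_def shortcut_configs_def)

section \<open>Balls of radius 2 as configurations\<close>

lemma reach_le_2: "reach_le E 2 v w \<longleftrightarrow> v = w \<or> E v w \<or> (\<exists>x. E v x \<and> E x w)"
  by (auto simp: numeral_2_eq_2)

lemma card_ball_2:
  assumes "simple_graph V E" "max_degree_le V E 7" "v \<in> V"
  shows "finite {w. reach_le E 2 v w}" "card {w. reach_le E 2 v w} \<le> 57"
proof -
  have nb: "finite {u. E x u} \<and> card {u. E x u} \<le> 7" if "x \<in> V" for x
    using assms that by (auto simp: simple_graph_def max_degree_le_def intro: finite_subset[of _ V])
  have vV: "E v x \<Longrightarrow> x \<in> V" for x using assms(1) by (auto simp: simple_graph_def)
  have eq: "{w. reach_le E 2 v w} = insert v ({u. E v u} \<union> (\<Union>x\<in>{u. E v u}. {u. E x u}))"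
    by (auto simp: reach_le_2)
  show "finite {w. reach_le E 2 v w}"
    unfolding eq using nb vV assms(3) by auto
  have "card (\<Union>x\<in>{u. E v u}. {u. E x u}) \<le> (\<Sum>x\<in>{u. E v u}. card {u. E x u})"
    using nb assms(3) by (intro card_UN_le) auto
  also have "\<dots> \<le> card {u. E v u} * 7"
    using nb vV by (metis (no_types, lifting) mem_Collect_eq sum_bounded_above of_nat_id)
  also have "\<dots> \<le> 49" using nb[OF assms(3)] by simp
  finally have "card ({u. E v u} \<union> (\<Union>x\<in>{u. E v u}. {u. E x u})) \<le> 7 + 49"
    using nb[OF assms(3)] by (meson add_mono card_Un_le order_trans)
  then show "card {w. reach_le E 2 v w} \<le> 57"
    unfolding eq using card_insert_le_m1[of 57] by simp
qed

text \<open>Edges leaving the closed neighbourhood of \<open>v\<close> end inside the radius-2 ball,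
  so an isomorphism of induced subgraphs sees all of them, and \<open>H\<close> has no vertices
  outside the image of the ball.\<close>

lemma neighbourhood_map_iso:
  assumes G: "simple_graph V E" and H: "simple_graph (lg_V H) (lg_E H)"
    and bij: "bij_betw f {w. reach_le E 2 v w} (lg_V H)"
    and iso: "\<And>u w. reach_le E 2 v u \<Longrightarrow> reach_le E 2 v w \<Longrightarrow> (E u w \<longleftrightarrow> lg_E H (f u) (f w)) \<and>
       (E u w \<longrightarrow> lin u w = lg_in H (f u) (f w))"
  shows "neighbourhood_map f {w. reach_le E 2 v w} (insert v {y. E v y}) v E (lg_E H) lin (lg_in H)"
proof (unfold_locales)
  show "inj_on f {w. reach_le E 2 v w}" using bij by (rule bij_betw_imp_inj_on)
  show "insert v {y. E v y} \<subseteq> {w. reach_le E 2 v w}" by (auto simp: reach_le_2)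
  show nb: "y \<in> {w. reach_le E 2 v w}" if "x \<in> insert v {y. E v y}" "E x y" for x y
    using that by (auto simp: reach_le_2)
  show "E y v" if "E v y" for y using G that by (auto simp: simple_graph_def)
  show "{z. lg_E H (f x) z} = f ` {y. E x y}" if x: "x \<in> insert v {y. E v y}" for x
  proof -
    have xB: "reach_le E 2 v x" using x by (auto simp: reach_le_2)
    have "z \<in> f ` {y. E x y}" if z: "lg_E H (f x) z" for z
    proof -
      have "z \<in> lg_V H" using z H by (auto simp: simple_graph_def)
      then obtain y where "reach_le E 2 v y" "z = f y" using bij by (auto simp: bij_betw_def)
      then show ?thesis using iso[OF xB] z by auto
    qed
    moreover have "lg_E H (f x) (f y)" if "E x y" for y
      using iso[OF xB] nb[OF x that] that by auto
    ultimately show ?thesis by auto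
  qed
  show "lg_in H (f x) (f y) = lin x y" if "x \<in> insert v {y. E v y}" "E x y" for x y
  proof -
    have "reach_le E 2 v x" "reach_le E 2 v y" using that by (auto simp: reach_le_2)
    then show ?thesis using iso that by simp
  qed
qed simp

lemma loc_valid_iso:
  assumes "simple_graph V E" "simple_graph (lg_V H) (lg_E H)"
    and "bij_betw f {w. reach_le E 2 v w} (lg_V H)"
    and iso: "\<And>u w. reach_le E 2 v u \<Longrightarrow> reach_le E 2 v w \<Longrightarrow> (E u w \<longleftrightarrow> lg_E H (f u) (f w)) \<and>
       (E u w \<longrightarrow> lin u w = lg_in H (f u) (f w) \<and> lout u w = lg_out H (f u) (f w))"
  shows "loc_valid (lg_E H) (lg_in H) (lg_out H) (f v) \<longleftrightarrow> loc_valid E lin lout v"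
proof -
  interpret neighbourhood_map f "{w. reach_le E 2 v w}" "insert v {y. E v y}" v E "lg_E H" lin "lg_in H"
    using assms by (intro neighbourhood_map_iso) auto
  show ?thesis
  proof (rule loc_valid_iff)
    fix x y assume "x \<in> insert v {y. E v y}" "E x y"
    then have "reach_le E 2 v x" "reach_le E 2 v y" by (auto simp: reach_le_2)
    then show "lg_out H (f x) (f y) = lout x y" using iso \<open>E x y\<close> by simp
  qed
qed

lemma ball_iso_config:
  assumes G: "simple_graph V E" and deg: "max_degree_le V E 7" and v: "v \<in> V"
    and lin: "\<forall>u w. E u w \<longrightarrow> lin u w \<in> {..6}" and lout: "\<forall>u w. E u w \<longrightarrow> lout u w \<in> {..4}"
    and loc: "loc_valid E lin lout v"
  shows "\<exists>H\<in>shortcut_configs. lg_iso (ball E lin lout 2 v) H"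
proof -
  define B where "B = {w. reach_le E 2 v w}"
  have B: "finite B" "card B \<le> 57" using card_ball_2[OF G deg v] by (simp_all add: B_def)
  \<comment> \<open>Configurations live on an initial segment of the naturals, so the ball is
    renumbered by \<open>f\<close> and its labels are pulled back along the inverse
    \<open>g\<close>.\<close>
  obtain f where f: "bij_betw f B {0..<card B}" using ex_bij_betw_finite_nat[OF B(1)] by blast
  define g where "g = inv_into B f"
  have gf: "g (f x) = x" if "x \<in> B" for x
    using f that by (simp add: g_def bij_betw_def)
  have fB: "f x < card B" if "x \<in> B" for x using f that by (auto simp: bij_betw_def)
  have vB: "v \<in> B" by (simp add: B_def reach_le_2)
  define EH where "EH a b \<longleftrightarrow> a < card B \<and> b < card B \<and> E (g a) (g b)" for a b
  define H where "H = LG {0..<card B} EH (\<lambda>a b. if EH a b then lin (g a) (g b) else 0)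
     (\<lambda>a b. if EH a b then lout (g a) (g b) else 0) (f v)"
  have EHf: "EH (f x) (f y) \<longleftrightarrow> E x y" if "x \<in> B" "y \<in> B" for x y
    using that by (simp add: EH_def gf fB)
  have simple: "simple_graph (lg_V H) (lg_E H)"
    using G by (auto simp: simple_graph_def H_def EH_def) 
  have reach: "reach_le EH 2 (f v) w" if "w < card B" for w
  proof -
    obtain x where x: "x \<in> B" "w = f x" using f \<open>w < card B\<close> by (auto simp: bij_betw_def image_iff Bex_def set_eq_iff)
    from x(1) consider "x = v" | "E v x" | y where "E v y" "E y x" by (auto simp: B_def reach_le_2)
    then show ?thesis
    proof cases
      case 3
      then have "y \<in> B" by (auto simp: B_def reach_le_2)
      then have "EH (f v) (f y)" "EH (f y) (f x)" using 3 EHf vB x by simp_all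
      then show ?thesis using x by (auto simp: reach_le_2)
    qed (use EHf vB x in \<open>auto simp: reach_le_2\<close>)
  qed
  have "loc_valid (lg_E H) (lg_in H) (lg_out H) (f v) \<longleftrightarrow> loc_valid E lin lout v"
  proof (rule loc_valid_iso[OF G simple])
    show "bij_betw f {w. reach_le E 2 v w} (lg_V H)" using f by (simp add: H_def B_def)
  next
    fix u w assume "reach_le E 2 v u" "reach_le E 2 v w"
    then have "u \<in> B" "w \<in> B" by (simp_all add: B_def)
    then show "(E u w \<longleftrightarrow> lg_E H (f u) (f w)) \<and>
       (E u w \<longrightarrow> lin u w = lg_in H (f u) (f w) \<and> lout u w = lg_out H (f u) (f w))"
      by (simp add: H_def EHf gf)
  qed
  then have "H \<in> shortcut_configs"
    using simple loc lin lout reach fB[OF vB] B(2)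
    by (auto simp: shortcut_configs_def H_def EH_def)
  moreover have "lg_iso (ball E lin lout 2 v) H"
    unfolding lg_iso_def using f vB
    by (intro exI[of _ f]) (auto simp: ball_def Let_def H_def EHf gf simp flip: B_def)
  ultimately show ?thesis by blast
qed

lemma config_iso_loc_valid:
  assumes G: "simple_graph V E" and H: "H \<in> shortcut_configs"
    and iso: "lg_iso (ball E lin lout 2 v) H"
  shows "loc_valid E lin lout v"
proof -
  obtain f where f: "bij_betw f {w. reach_le E 2 v w} (lg_V H)" "f v = lg_c H"
    and eq: "\<forall>u\<in>{w. reach_le E 2 v w}. \<forall>w\<in>{w. reach_le E 2 v w}.
       (E u w \<longleftrightarrow> lg_E H (f u) (f w)) \<and>
       (E u w \<longrightarrow> lin u w = lg_in H (f u) (f w) \<and> lout u w = lg_out H (f u) (f w))"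
    using iso by (auto simp: lg_iso_def ball_def Let_def)
  have simple: "simple_graph (lg_V H) (lg_E H)" using H by (simp add: shortcut_configs_def)
  have "loc_valid (lg_E H) (lg_in H) (lg_out H) (f v) \<longleftrightarrow> loc_valid E lin lout v"
    using eq by (intro loc_valid_iso[OF G simple f(1)]) auto
  then show ?thesis using H f(2) by (simp add: shortcut_configs_def)
qed

text \<open>Since the rules at a node depend only on its radius-2 ball, an isomorphic configuration
  exists exactly when they hold there; later arguments work with \<open>loc_valid\<close>
  alone.\<close>

lemma shortcut_lcl_valid_iff:
  assumes inst: "lcl_instance shortcut_lcl 7 c n V E lin"
  shows "lcl_valid shortcut_lcl V E lin lout \<longleftrightarrow>
    (\<forall>u w. E u w \<longrightarrow> lout u w \<le> 4) \<and> (\<forall>v\<in>V. loc_valid E lin lout v)"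
proof -
  have G: "simple_graph V E" "max_degree_le V E 7" "\<forall>u w. E u w \<longrightarrow> lin u w \<in> {..6}"
    using inst by (auto simp: lcl_instance_def)
  have "(\<exists>H\<in>shortcut_configs. lg_iso (ball E lin lout 2 v) H) \<longleftrightarrow> loc_valid E lin lout v"
    if "v \<in> V" "\<forall>u w. E u w \<longrightarrow> lout u w \<in> {..4}" for v
    using ball_iso_config[OF G(1,2) that(1) G(3) that(2)] config_iso_loc_valid[OF G(1)] by metis
  then show ?thesis by (auto simp: lcl_valid_def)
qed

section \<open>Defect-free components\<close>

lemma reach_le_refl [simp]: "reach_le E k v v"
  by (cases k) auto

lemma reach_le_mono: "reach_le E k v w \<Longrightarrow> k \<le> l \<Longrightarrow> reach_le E l v w"
proof (induction k arbitrary: l v)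
  case (Suc k)
  then show ?case by (cases l) auto
qed simp

lemma reach_le_trans: "reach_le E k u v \<Longrightarrow> reach_le E l v w \<Longrightarrow> reach_le E (k + l) u w"
proof (induction k arbitrary: u)
  case (Suc k)
  then show ?case using reach_le_mono[of E l v w "Suc (k + l)"] by auto
qed simp

lemma reach_le_edge: "E v w \<Longrightarrow> reach_le E (Suc 0) v w"
  by auto

lemma reach_le_snocD:
  "reach_le E (Suc k) v w \<Longrightarrow> reach_le E k v w \<or> (\<exists>x. reach_le E k v x \<and> E x w)"
proof (induction k arbitrary: v)
  case (Suc k)
  from Suc.prems consider "v = w" | x where "E v x" "reach_le E (Suc k) x w"
    by auto
  then show ?case
  proof cases
    case 2
    then show ?thesis using Suc.IH[of x] by auto
  qed simp
qed auto

lemma reach_le_sym: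
  assumes "\<And>u w. E u w \<Longrightarrow> E w u"
  shows "reach_le E k v w \<Longrightarrow> reach_le E k w v"
proof (induction k arbitrary: v)
  case (Suc k)
  from Suc.prems consider "v = w" | x where "E v x" "reach_le E k x w"
    by auto
  then show ?case
  proof cases
    case 2
    then have "reach_le E k w x" "reach_le E (Suc 0) x v" using Suc.IH assms by auto
    then show ?thesis using reach_le_trans by fastforce
  qed simp
qed simp

section \<open>Pointers to defects and the labelling they induce\<close>

primrec err_below ::
  "(nat \<Rightarrow> nat \<Rightarrow> bool) \<Rightarrow> (nat \<Rightarrow> nat \<Rightarrow> nat) \<Rightarrow> nat \<Rightarrow> nat \<Rightarrow> bool" where
  "err_below E lin 0 v \<longleftrightarrow> \<not> node_ok E lin v"
| "err_below E lin (Suc k) v \<longleftrightarrow> \<not> node_ok E lin v \<or> (\<exists>u\<in>chi E lin v. err_below E lin k u)"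

primrec err_seen ::
  "(nat \<Rightarrow> nat \<Rightarrow> bool) \<Rightarrow> (nat \<Rightarrow> nat \<Rightarrow> nat) \<Rightarrow> nat \<Rightarrow> nat \<Rightarrow> nat \<Rightarrow> bool" where
  "err_seen E lin M 0 v \<longleftrightarrow> err_below E lin M v"
| "err_seen E lin M (Suc k) v \<longleftrightarrow>
     err_below E lin M v \<or> (\<exists>u\<in>par E lin v. err_seen E lin M k u)"

text \<open>A closure of a relation is taken because successors may branch or form cycles where
  there are defects. A row without a start reads as 0, which the rules permit.\<close>

definition row_bit :: "(nat \<Rightarrow> nat \<Rightarrow> bool) \<Rightarrow> (nat \<Rightarrow> nat \<Rightarrow> nat) \<Rightarrow> nat \<Rightarrow> bool" where
  "row_bit E lin v \<longleftrightarrow> (\<exists>y z. (\<lambda>x x'. x' \<in> nxt E lin x)\<^sup>*\<^sup>* y v \<and> prv E lin y = {} \<and>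
     E y z \<and> lin y z = 4)"

text \<open>\<open>M\<close> bounds both the climb and the descent. It will be chosen with n < 2^M,
  beyond the depth of any defect-free tree on n nodes.\<close>

definition node_label ::
  "(nat \<Rightarrow> nat \<Rightarrow> bool) \<Rightarrow> (nat \<Rightarrow> nat \<Rightarrow> nat) \<Rightarrow> nat \<Rightarrow> nat \<Rightarrow> nat" where
  "node_label E lin M v =
     (if \<not> node_ok E lin v then 2 else if err_below E lin M v then 3
      else if err_seen E lin M M v then 4 else of_bool (row_bit E lin v))"

primrec level ::
  "(nat \<Rightarrow> nat \<Rightarrow> bool) \<Rightarrow> (nat \<Rightarrow> nat \<Rightarrow> nat) \<Rightarrow> nat \<Rightarrow> nat \<Rightarrow> nat set" where
  "level E lin u 0 = {u}"
| "level E lin u (Suc s) = (\<Union>x\<in>level E lin u s. chi E lin x)"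

lemma err_below_mono: "err_below E lin k v \<Longrightarrow> k \<le> l \<Longrightarrow> err_below E lin l v"
proof (induction k arbitrary: l v)
  case 0
  then show ?case by (cases l) auto
next
  case (Suc k)
  then show ?case by (cases l) auto
qed

lemma err_seen_mono: "err_seen E lin M k v \<Longrightarrow> k \<le> l \<Longrightarrow> err_seen E lin M l v"
proof (induction k arbitrary: l v)
  case 0
  then show ?case by (cases l) auto
next
  case (Suc k)
  then show ?case by (cases l) auto
qed

lemma err_below_level:
  "x \<in> level E lin u s \<Longrightarrow> err_below E lin j x \<Longrightarrow> err_below E lin (s + j) u"
proof (induction s arbitrary: x j)
  case (Suc s)
  then obtain y where "y \<in> level E lin u s" "x \<in> chi E lin y" by auto
  then show ?case using Suc.IH[of y "Suc j"] Suc.prems by auto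
qed simp

locale labelled_graph =
  fixes V :: "nat set" and E :: "nat \<Rightarrow> nat \<Rightarrow> bool" and lin :: "nat \<Rightarrow> nat \<Rightarrow> nat"
  assumes simple: "simple_graph V E"
begin

lemma finite_V: "finite V" and edge_V: "E u w \<Longrightarrow> u \<in> V \<and> w \<in> V" and edge_sym: "E u w \<Longrightarrow> E w u"
  using simple by (auto simp: simple_graph_def)

lemma node_okD:
  assumes "node_ok E lin v"
  shows "\<forall>y\<in>{y. E v y}. (lin v y, lin y v) \<in> port_pairs"
    and "\<forall>y\<in>par E lin v. \<forall>z\<in>par E lin v. y = z"
    and "\<forall>y\<in>nxt E lin v. \<forall>z\<in>nxt E lin v. y = z"
    and "\<forall>y\<in>prv E lin v. \<forall>z\<in>prv E lin v. y = z"
    and "\<forall>y\<in>chi E lin v. \<exists>z\<in>chi E lin v. z \<noteq> y \<and> z \<in> lat E lin y \<and>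
        (\<forall>u\<in>chi E lin v. u = y \<or> u = z)"
    and "\<forall>z\<in>lat E lin v. (\<exists>p\<in>par E lin v. \<exists>q\<in>par E lin z. p = q \<or> q \<in> lat E lin p) \<and>
        (chi E lin v = {} \<longleftrightarrow> chi E lin z = {}) \<and>
        (chi E lin v \<noteq> {} \<longrightarrow> (\<exists>y\<in>chi E lin v. \<exists>y'\<in>chi E lin z. y' \<in> lat E lin y))"
  using assms unfolding node_ok_def by - (elim conjE, assumption)+

lemma pairing:
  assumes "node_ok E lin v" "E v y"
  shows "(lin v y, lin y v) \<in> {(0,1),(1,0),(2,2),(3,5),(4,5),(5,3),(5,4),(6,6)}"
  using node_okD(1)[OF assms(1)] assms(2) by (simp only: port_pairs_def ball_simps mem_Collect_eq)

lemma par_unique: "node_ok E lin v \<Longrightarrow> y \<in> par E lin v \<Longrightarrow> z \<in> par E lin v \<Longrightarrow> y = z"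
  and nxt_unique: "node_ok E lin v \<Longrightarrow> y \<in> nxt E lin v \<Longrightarrow> z \<in> nxt E lin v \<Longrightarrow> y = z"
  and prv_unique: "node_ok E lin v \<Longrightarrow> y \<in> prv E lin v \<Longrightarrow> z \<in> prv E lin v \<Longrightarrow> y = z"
  using node_okD(2-4)[of v] by blast+

lemma chi_pair:
  assumes "node_ok E lin v" "y \<in> chi E lin v"
  obtains z where "z \<noteq> y" "z \<in> lat E lin y" "chi E lin v = {y, z}"
proof -
  obtain z where "z \<in> chi E lin v" "z \<noteq> y" "z \<in> lat E lin y" "\<forall>u\<in>chi E lin v. u = y \<or> u = z"
    using bspec[OF node_okD(5)[OF assms(1)] assms(2)] by (elim bexE conjE)
  then show ?thesis using that[of z] assms(2) by blast
qed

lemma lat_par: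
  assumes "node_ok E lin v" "z \<in> lat E lin v"
  obtains p q where "p \<in> par E lin v" "q \<in> par E lin z" "p = q \<or> q \<in> lat E lin p"
  using bspec[OF node_okD(6)[OF assms(1)] assms(2)] by (elim bexE conjE)

lemma lat_chi:
  assumes "node_ok E lin v" "z \<in> lat E lin v"
  shows "chi E lin v = {} \<longleftrightarrow> chi E lin z = {}"
    and "chi E lin v \<noteq> {} \<Longrightarrow> \<exists>y\<in>chi E lin v. \<exists>y'\<in>chi E lin z. y' \<in> lat E lin y"
  using bspec[OF node_okD(6)[OF assms(1)] assms(2)] by simp_all

text \<open>The pairing of labels is a rule of each endpoint, so a port can be carried across an
  edge as soon as one endpoint is defect-free; the primed variants place that hypothesis at the
  other end.\<close>

lemma par_chi: "node_ok E lin v \<Longrightarrow> p \<in> par E lin v \<Longrightarrow> v \<in> chi E lin p"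
  using pairing[of v p] edge_sym by (auto simp: port_def)

lemma par_chi': "node_ok E lin p \<Longrightarrow> p \<in> par E lin v \<Longrightarrow> v \<in> chi E lin p"
  using pairing[of p v] edge_sym by (auto simp: port_def)

lemma chi_par: "node_ok E lin v \<Longrightarrow> y \<in> chi E lin v \<Longrightarrow> v \<in> par E lin y"
  using pairing[of v y] edge_sym by (auto simp: port_def)

lemma nxt_prv: "node_ok E lin v \<Longrightarrow> y \<in> nxt E lin v \<Longrightarrow> v \<in> prv E lin y"
  using pairing[of v y] edge_sym by (auto simp: port_def)

lemma nxt_prv': "node_ok E lin y \<Longrightarrow> y \<in> nxt E lin v \<Longrightarrow> v \<in> prv E lin y"
  using pairing[of y v] edge_sym by (auto simp: port_def)

text \<open>The predecessor of \<open>u\<close> is unique, so a nontrivial walk into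
  \<open>u\<close> passes through \<open>v\<close>; the trivial one would begin at \<open>u\<close>,
  which has a predecessor and is no start.\<close>

lemma row_bit_nxt:
  assumes v: "node_ok E lin v" and u: "node_ok E lin u" and nxt: "u \<in> nxt E lin v"
  shows "row_bit E lin u \<longleftrightarrow> row_bit E lin v"
proof
  assume "row_bit E lin u"
  then obtain y z where y: "(\<lambda>x x'. x' \<in> nxt E lin x)\<^sup>*\<^sup>* y u" "prv E lin y = {}" "E y z" "lin y z = 4"
    by (auto simp: row_bit_def)
  from y(1) have "(\<lambda>x x'. x' \<in> nxt E lin x)\<^sup>*\<^sup>* y v"
  proof (cases rule: rtranclp.cases)
    case rtrancl_refl
    then show ?thesis using nxt_prv[OF v nxt] y(2) by auto
  next
    case (rtrancl_into_rtrancl x)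
    then have "x = v" using nxt_prv[OF v nxt] nxt_prv'[OF u] prv_unique[OF u] by blast
    then show ?thesis using rtrancl_into_rtrancl by simp
  qed
  then show "row_bit E lin v" using y by (auto simp: row_bit_def)
next
  assume "row_bit E lin v"
  then show "row_bit E lin u"
    using nxt by (auto simp: row_bit_def intro: rtranclp.rtrancl_into_rtrancl)
qed

lemma row_bit_start:
  assumes v: "node_ok E lin v" and prv: "prv E lin v = {}" and nxt: "u \<in> nxt E lin v"
  shows "lin v u = 3 + of_bool (row_bit E lin v)"
proof -
  have "row_bit E lin v \<longleftrightarrow> lin v u = 4"
  proof
    assume "row_bit E lin v"
    then obtain y z where y: "(\<lambda>x x'. x' \<in> nxt E lin x)\<^sup>*\<^sup>* y v" "E y z" "lin y z = 4"
      by (auto simp: row_bit_def)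
    from y(1) have "y = v"
      by (cases rule: rtranclp.cases) (use nxt_prv'[OF v] prv in auto)
    then have "z \<in> nxt E lin v" using y by (simp add: port_def)
    then show "lin v u = 4" using nxt_unique[OF v nxt] y \<open>y = v\<close> by simp
  next
    assume "lin v u = 4"
    then show "row_bit E lin v"
      using prv nxt unfolding row_bit_def port_def by blast
  qed
  then show ?thesis using nxt by (auto simp: port_def)
qed

lemma node_label_le: "node_label E lin M v \<le> 4"
  by (simp add: node_label_def)

text \<open>Cutting the search off at \<open>M\<close> is consistent: the defect behind a pointer is
  one step nearer to some child or parent, and monotonicity raises that smaller bound back to
  \<open>M\<close>, so this neighbour carries a suitable pointer itself.\<close>

lemma loc_valid_node_label: "loc_valid E lin (\<lambda>v u. node_label E lin M v) v"
  unfolding loc_valid_def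
proof (intro exI conjI impI)
  let ?a = "node_label E lin M v"
  show "?a \<le> 4" by (rule node_label_le)
  show "\<not> node_ok E lin v" if "?a = 2"
    using that by (auto simp: node_label_def of_bool_def split: if_splits)
  show "\<exists>u\<in>chi E lin v. node_label E lin M u \<in> {2,3}" if "?a = 3"
  proof -
    have v: "node_ok E lin v" "err_below E lin M v"
      using that by (auto simp: node_label_def of_bool_def split: if_splits)
    then obtain k where k: "M = Suc k" by (cases M) auto
    then obtain u where u: "u \<in> chi E lin v" "err_below E lin k u" using v by auto
    then have "err_below E lin M u" using k err_below_mono by (metis le_Suc_eq order_refl)
    then show ?thesis using u by (intro bexI[of _ u]) (simp_all add: node_label_def)
  qed
  show "\<exists>u\<in>par E lin v. node_label E lin M u \<in> {2,3,4}" if "?a = 4"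
  proof -
    have v: "\<not> err_below E lin M v" "err_seen E lin M M v"
      using that by (auto simp: node_label_def of_bool_def split: if_splits)
    then obtain k where k: "M = Suc k" by (cases M) auto
    then obtain u where u: "u \<in> par E lin v" "err_seen E lin M k u"
      using v by (metis err_seen.simps(2))
    then have "err_seen E lin M M u" using k err_seen_mono by (metis le_Suc_eq order_refl)
    then show ?thesis using u by (intro bexI[of _ u]) (simp_all add: node_label_def)
  qed
  assume "?a \<le> 1"
  then have v: "node_ok E lin v" "?a = of_bool (row_bit E lin v)"
    by (auto simp: node_label_def of_bool_def split: if_splits)
  show "\<forall>u\<in>nxt E lin v. node_label E lin M u = ?a \<or> 2 \<le> node_label E lin M u"
  proof
    fix u assume u: "u \<in> nxt E lin v"
    show "node_label E lin M u = ?a \<or> 2 \<le> node_label E lin M u"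
    proof (cases "2 \<le> node_label E lin M u")
      case False
      then have "node_ok E lin u" "node_label E lin M u = of_bool (row_bit E lin u)"
        by (auto simp: node_label_def of_bool_def split: if_splits)
      then show ?thesis using row_bit_nxt[OF v(1) _ u] v(2) by simp
    qed simp
  qed
  show "\<forall>u\<in>nxt E lin v. lin v u = 3 + ?a" if "prv E lin v = {}"
    using row_bit_start[OF v(1) that] v(2) by simp
qed simp

section \<open>Levels of a defect-free subtree\<close>

lemma level_subset: "u \<in> V \<Longrightarrow> level E lin u s \<subseteq> V"
proof (induction s)
  case (Suc s)
  then show ?case using edge_V by (auto simp: port_def)
qed simp

lemma level_ok:
  assumes "\<not> err_below E lin k u" "s \<le> k" "x \<in> level E lin u s"
  shows "node_ok E lin x"
proof (rule ccontr)
  assume "\<not> node_ok E lin x"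
  then have "err_below E lin s u" using err_below_level[OF assms(3), of 0] by simp
  then show False using err_below_mono assms by blast
qed

abbreviation lat_in :: "nat set \<Rightarrow> nat \<Rightarrow> nat \<Rightarrow> bool" where
  "lat_in S \<equiv> (\<lambda>x y. y \<in> S \<and> y \<in> lat E lin x)\<^sup>*\<^sup>*"

lemma lat_in_leaf:
  assumes "\<forall>x\<in>S. node_ok E lin x" and "lat_in S x y" and "x \<in> S"
  shows "y \<in> S \<and> (chi E lin x = {} \<longleftrightarrow> chi E lin y = {})"
  using assms(2,3,1)
proof (induction rule: rtranclp_induct)
  case (step y z)
  then show ?case using lat_chi(1)[of y z] by auto
qed simp

text \<open>Siblings are adjacent, and adjacent parents have some pair of adjacent children; a
  lateral path between parents therefore lifts to one between any of their children.\<close>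

lemma level_lat_connected:
  assumes "\<not> err_below E lin k u" "s \<le> k" "x \<in> level E lin u s" "y \<in> level E lin u s"
  shows "lat_in (level E lin u s) x y"
  using assms(2-)
proof (induction s arbitrary: x y)
  case (Suc s)
  let ?L = "level E lin u s" and ?L' = "level E lin u (Suc s)"
  have ok: "\<forall>x\<in>?L. node_ok E lin x"
    using level_ok[OF assms(1), of s] Suc.prems(1) by simp
  have sib: "lat_in ?L' x y" if p: "p \<in> ?L" "x \<in> chi E lin p" and y: "y \<in> chi E lin p" for p x y
  proof -
    obtain z where z: "z \<in> lat E lin x" "chi E lin p = {x, z}"
      using chi_pair[OF bspec[OF ok p(1)] p(2)] by blast
    have "y = x \<or> y = z" using z y by auto
    moreover have "y \<in> ?L'" using p y by auto
    ultimately show ?thesis using z(1) by (auto intro: r_into_rtranclp)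
  qed
  have cousins: "lat_in ?L' x y"
    if "lat_in ?L p q" "p \<in> ?L" "x \<in> chi E lin p" "y \<in> chi E lin q" for p q x y
    using that
  proof (induction arbitrary: y rule: rtranclp_induct)
    case base
    then show ?case using sib by blast
  next
    case (step q' q)
    have q': "q' \<in> ?L" using lat_in_leaf[OF ok step.hyps(1) step.prems(1)] by simp
    have "chi E lin q' \<noteq> {}" using lat_chi(1)[of q' q] ok q' step by auto
    then obtain a b where ab: "a \<in> chi E lin q'" "b \<in> chi E lin q" "b \<in> lat E lin a"
      using lat_chi(2)[of q' q] ok q' step.hyps by blast
    have "b \<in> ?L' \<and> b \<in> lat E lin a" using ab step.hyps by auto
    moreover have "lat_in ?L' x a" using step.IH step.prems ab by blast
    ultimately have "lat_in ?L' x b" by (rule rtranclp.rtrancl_into_rtrancl[rotated])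
    then show ?case
      by (rule rtranclp_trans) (use sib[OF _ ab(2) step.prems(3)] step.hyps(2) in simp)
  qed
  from Suc.prems obtain p q where "p \<in> ?L" "q \<in> ?L" "x \<in> chi E lin p" "y \<in> chi E lin q"
    by auto
  then show ?case using cousins[of p q x y] Suc.IH[of p q] Suc.prems(1) by simp
qed simp

text \<open>Being a leaf is constant along lateral paths, so either all nodes of a level have
  children or none has. In the first case each has two, and none is shared because parents are
  unique.\<close>

lemma card_level:
  assumes "u \<in> V" "\<not> err_below E lin k u" "s \<le> k" "level E lin u s \<noteq> {}"
  shows "card (level E lin u s) = 2 ^ s"
  using assms(3,4)
proof (induction s)
  case (Suc s)
  let ?L = "level E lin u s" and ?L' = "level E lin u (Suc s)"
  have ok: "\<forall>x\<in>?L. node_ok E lin x" "\<forall>x\<in>?L'. node_ok E lin x"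
    using level_ok[OF assms(2), of s] level_ok[OF assms(2), of "Suc s"] Suc.prems(1) by simp_all
  obtain x where x: "x \<in> ?L" "chi E lin x \<noteq> {}" using Suc.prems by auto
  have ne: "chi E lin y \<noteq> {}" if "y \<in> ?L" for y
    using lat_in_leaf[OF ok(1) level_lat_connected[OF assms(2) _ x(1) that] x(1)] x(2) Suc.prems
    by simp
  have card2: "card (chi E lin y) = 2" if y: "y \<in> ?L" for y
  proof -
    obtain a where a: "a \<in> chi E lin y" using ne[OF y] by blast
    then show ?thesis using ok(1) y by (auto elim!: chi_pair[of y a])
  qed
  have "card ?L' = (\<Sum>y\<in>?L. card (chi E lin y))"
    unfolding level.simps
  proof (rule card_UN_disjoint)
    show "finite ?L" using level_subset[OF assms(1)] finite_V by (rule finite_subset)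
    show "\<forall>i\<in>?L. finite (chi E lin i)" using card2 by (metis card.infinite zero_neq_numeral)
    show "\<forall>i\<in>?L. \<forall>j\<in>?L. i \<noteq> j \<longrightarrow> chi E lin i \<inter> chi E lin j = {}"
    proof (intro ballI impI)
      fix i j assume ij: "i \<in> ?L" "j \<in> ?L" "i \<noteq> j"
      have False if "a \<in> chi E lin i" "a \<in> chi E lin j" for a
      proof -
        have "node_ok E lin a" using ok(2) ij(1) that(1) by auto
        then show False
          using par_unique chi_par[OF bspec[OF ok(1) ij(1)] that(1)]
            chi_par[OF bspec[OF ok(1) ij(2)] that(2)] ij(3) by blast
      qed
      then show "chi E lin i \<inter> chi E lin j = {}" by blast
    qed
  qed
  also have "\<dots> = 2 ^ Suc s" using card2 Suc.IH x(1) Suc.prems(1) by auto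
  finally show ?case .
qed simp

lemma card_level_le: "u \<in> V \<Longrightarrow> \<not> err_below E lin k u \<Longrightarrow> s \<le> k \<Longrightarrow> level E lin u s \<noteq> {} \<Longrightarrow>
    2 ^ s \<le> card V"
  using card_level[of u k s] card_mono[OF finite_V level_subset[of u s]] by simp

lemma ancestor:
  assumes "\<not> err_seen E lin M k v" "v \<in> V"
  shows "\<exists>r s. r \<in> V \<and> s \<le> k \<and> v \<in> level E lin r s \<and> \<not> err_below E lin M r \<and>
     (s = k \<or> par E lin r = {})"
  using assms
proof (induction k arbitrary: v)
  case 0
  then show ?case by (intro exI[of _ v] exI[of _ 0]) auto
next
  case (Suc k)
  have v: "\<not> err_below E lin M v" using Suc.prems by auto
  then have ok: "node_ok E lin v" using level_ok[of M v 0 v] by simp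
  show ?case
  proof (cases "par E lin v = {}")
    case True
    then show ?thesis using v Suc.prems by (intro exI[of _ v] exI[of _ 0]) auto
  next
    case False
    then obtain p where p: "p \<in> par E lin v" by blast
    then have "p \<in> V" using edge_V by (auto simp: port_def)
    moreover have "\<not> err_seen E lin M k p" using p Suc.prems by auto
    ultimately obtain r s where rs: "r \<in> V" "s \<le> k" "p \<in> level E lin r s" "\<not> err_below E lin M r"
      "s = k \<or> par E lin r = {}"
      using Suc.IH by blast
    moreover have "v \<in> level E lin r (Suc s)" using par_chi[OF ok p] rs(3) by auto
    ultimately show ?thesis by (intro exI[of _ r] exI[of _ "Suc s"]) auto
  qed
qed

lemma level_reach: "x \<in> level E lin u s \<Longrightarrow> reach_le E s u x"
proof (induction s arbitrary: x)
  case (Suc s)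
  then obtain y where "reach_le E s u y" "E y x" by (auto simp: port_def)
  then show ?case using reach_le_trans[of E s u y "Suc 0" x] reach_le_edge[of E y x] by simp
qed simp

text \<open>Doubling levels cannot reach depth \<open>M\<close> with fewer than 2^M nodes. So the
  climb from \<open>v\<close> ends at a node without parent whose level \<open>M\<close> is empty,
  and the levels above that are closed under all edges but padding. The radius is \<open>M\<close>
  up plus \<open>M\<close> down.\<close>

lemma error_free_component:
  assumes v: "v \<in> V" and noerr: "\<not> err_seen E lin M M v" and M: "card V < 2 ^ M"
  obtains S where "v \<in> S" "\<And>x. x \<in> S \<Longrightarrow> node_ok E lin x" "\<And>x. x \<in> S \<Longrightarrow> reach_le E (2 * M) v x"
    "\<And>x y. x \<in> S \<Longrightarrow> E x y \<Longrightarrow> lin x y \<noteq> 6 \<Longrightarrow> y \<in> S"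
proof -
  obtain r s where rs: "r \<in> V" "s \<le> M" "v \<in> level E lin r s" "\<not> err_below E lin M r"
     "s = M \<or> par E lin r = {}"
    using ancestor[OF noerr v] by blast
  have short: "t < M" if "t \<le> M" "x \<in> level E lin r t" for t x
  proof -
    have "2 ^ t \<le> card V" using card_level_le rs that by blast
    then show ?thesis using that(1) M by (cases "t = M") auto
  qed
  \<comment> \<open>Had the climb used all \<open>M\<close> steps, \<open>v\<close> would lie in
    level \<open>M\<close> below \<open>r\<close>, contradicting \<open>short\<close>.\<close>
  have root: "par E lin r = {}" using short rs by blast
  define S where "S = (\<Union>t\<in>{..<M}. level E lin r t)"
  have ok: "node_ok E lin x" if "x \<in> level E lin r t" "t \<le> M" for x t
    using level_ok rs that by blast
  \<comment> \<open>Lateral neighbours have equal or laterally adjacent parents, which gives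
    induction on the depth; the root has no lateral neighbour because that would require a
    parent.\<close>
  have lat_level: "z \<in> level E lin r t" if "t < M" "x \<in> level E lin r t" "z \<in> lat E lin x" for t x z
    using that
  proof (induction t arbitrary: x z)
    case 0
    then show ?case using root ok[of r 0] by (auto elim!: lat_par)
  next
    case (Suc t)
    obtain p q where pq: "p \<in> par E lin x" "q \<in> par E lin z" "p = q \<or> q \<in> lat E lin p"
      using lat_par[OF ok[OF Suc.prems(2)] Suc.prems(3)] Suc.prems(1) by auto
    obtain p' where p': "p' \<in> level E lin r t" "x \<in> chi E lin p'" using Suc.prems by auto
    then have "p' \<in> par E lin x" using chi_par ok Suc.prems by simp
    then have "p = p'" using par_unique[OF ok[OF Suc.prems(2)]] Suc.prems(1) pq(1) by simp
    then have q: "q \<in> level E lin r t" using pq(3) p' Suc.IH[of p q] Suc.prems(1) by auto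
    then have "z \<in> chi E lin q" using par_chi' pq(2) ok Suc.prems(1) by simp
    then show ?case using q by auto
  qed
  show thesis
  proof (rule that)
    show "v \<in> S" using rs short by (auto simp: S_def)
    show "node_ok E lin x" if "x \<in> S" for x using that ok by (auto simp: S_def)
    show "reach_le E (2 * M) v x" if "x \<in> S" for x
    proof -
      obtain t where t: "t < M" "x \<in> level E lin r t" using \<open>x \<in> S\<close> by (auto simp: S_def)
      have "reach_le E s v r" by (rule reach_le_sym[OF edge_sym level_reach[OF rs(3)]])
      then have "reach_le E (s + t) v x" by (rule reach_le_trans[OF _ level_reach[OF t(2)]])
      then show ?thesis using rs t by (elim reach_le_mono) simp
    qed
    show "y \<in> S" if "x \<in> S" and xy: "E x y" "lin x y \<noteq> 6" for x y
    proof -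
      obtain t where t: "t < M" "x \<in> level E lin r t" using \<open>x \<in> S\<close> by (auto simp: S_def)
      have okx: "node_ok E lin x" using ok t by simp
      have "lin x y \<in> {0,1,2,3,4,5,6}" using pairing[OF okx xy(1)] by auto
      then consider "y \<in> par E lin x" | "y \<in> chi E lin x" | "y \<in> lat E lin x"
        using xy by (auto simp: port_def)
      then show ?thesis
      proof cases
        case 1
        then obtain t' where t': "t = Suc t'" using t root by (cases t) auto
        then obtain p where p: "p \<in> level E lin r t'" "x \<in> chi E lin p" using t by auto
        then have "p \<in> par E lin x" using chi_par ok t t' by simp
        then have "p = y" using par_unique okx 1 by blast
        then show ?thesis using p t t' by (auto simp: S_def)
      next
        case 2
        then have y: "y \<in> level E lin r (Suc t)" using t by auto
        then have "Suc t \<in> {..<M}" using short[of "Suc t" y] t by simp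
        then show ?thesis using y unfolding S_def by (rule UN_I)
      next
        case 3
        then show ?thesis using lat_level[OF t] t unfolding S_def by blast
      qed
    qed
  qed
qed

end

section \<open>The LOCAL algorithm\<close>

definition agree_at :: "(nat \<Rightarrow> nat \<Rightarrow> bool) \<Rightarrow> (nat \<Rightarrow> nat \<Rightarrow> nat) \<Rightarrow> (nat \<Rightarrow> nat \<Rightarrow> bool)
    \<Rightarrow> (nat \<Rightarrow> nat \<Rightarrow> nat) \<Rightarrow> nat \<Rightarrow> bool" where
  "agree_at E lin E' lin' x \<longleftrightarrow> (\<forall>y. E' x y = E x y \<and> (E x y \<longrightarrow> lin' x y = lin x y))"

lemma agree_at_port: "agree_at E lin E' lin' x \<Longrightarrow> port E' lin' L x = port E lin L x"
  by (auto simp: agree_at_def port_def)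

section \<open>Locality of the labelling\<close>

locale agreeing_graphs = labelled_graph V E lin for V E lin +
  fixes E' :: "nat \<Rightarrow> nat \<Rightarrow> bool" and lin' :: "nat \<Rightarrow> nat \<Rightarrow> nat"
begin

lemma node_ok_cong:
  assumes "\<And>x. reach_le E (Suc 0) v x \<Longrightarrow> agree_at E lin E' lin' x"
  shows "node_ok E' lin' v \<longleftrightarrow> node_ok E lin v"
proof -
  have "agree_at E lin E' lin' x" if "x \<in> insert v {y. E v y}" for x
    using assms that by auto
  then interpret neighbourhood_map id UNIV "insert v {y. E v y}" v E E' lin lin'
    by unfold_locales (auto simp: agree_at_def edge_sym)
  show ?thesis using node_ok_iff by simp
qed

lemma err_below_cong:
  assumes "\<And>x. reach_le E (Suc k) v x \<Longrightarrow> agree_at E lin E' lin' x"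
  shows "err_below E' lin' k v \<longleftrightarrow> err_below E lin k v"
  using assms
proof (induction k arbitrary: v)
  case 0
  then show ?case using node_ok_cong by simp
next
  case (Suc k)
  have ok: "node_ok E' lin' v \<longleftrightarrow> node_ok E lin v"
    using Suc.prems reach_le_mono[of E "Suc 0" v _ "Suc (Suc k)"] by (intro node_ok_cong) auto
  have chi: "chi E' lin' v = chi E lin v"
    using Suc.prems[of v] by (intro agree_at_port) simp
  have "err_below E' lin' k u \<longleftrightarrow> err_below E lin k u" if "u \<in> chi E lin v" for u
  proof (rule Suc.IH)
    fix x assume "reach_le E (Suc k) u x"
    then have "reach_le E (Suc (Suc k)) v x"
      using port_nbr[OF that] by (simp only: reach_le.simps(2)[of E "Suc k"]) blast
    then show "agree_at E lin E' lin' x" by (rule Suc.prems)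
  qed
  then show ?case by (simp add: ok chi[simplified])
qed

text \<open>The radius counts \<open>k\<close> steps up, \<open>M\<close> down and one to the
  neighbours whose ports the rules inspect; \<open>k = M\<close> gives the 2M + 1 rounds of the
  algorithm.\<close>

lemma err_seen_cong:
  assumes "\<And>x. reach_le E (k + Suc M) v x \<Longrightarrow> agree_at E lin E' lin' x"
  shows "err_seen E' lin' M k v \<longleftrightarrow> err_seen E lin M k v"
  using assms
proof (induction k arbitrary: v)
  case 0
  then show ?case using err_below_cong[of M v] by simp
next
  case (Suc k)
  have below: "err_below E' lin' M v \<longleftrightarrow> err_below E lin M v"
    using Suc.prems reach_le_mono[of E "Suc M" v _ "Suc k + Suc M"] by (intro err_below_cong) auto
  have par: "par E' lin' v = par E lin v"
    using Suc.prems[of v] by (intro agree_at_port) simp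
  have "err_seen E' lin' M k u \<longleftrightarrow> err_seen E lin M k u" if "u \<in> par E lin v" for u
  proof (rule Suc.IH)
    fix x assume "reach_le E (k + Suc M) u x"
    then have "reach_le E (Suc k + Suc M) v x"
      using port_nbr[OF that] by (auto simp: reach_le.simps(2))
    then show "agree_at E lin E' lin' x" by (rule Suc.prems)
  qed
  then show ?case by (simp add: below par)
qed

text \<open>The walk from the start of the row to \<open>v\<close> may be much longer than
  \<open>2 * M\<close>, but traced backwards from \<open>v\<close> it never leaves the defect-free
  component, all of which lies within that distance.\<close>

lemma row_bit_transfer:
  assumes v: "v \<in> V" and noerr: "\<not> err_seen E lin M M v" and M: "card V < 2 ^ M"
    and agree: "\<And>x. reach_le E (2 * M) v x \<Longrightarrow> agree_at E lin E' lin' x"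
    and bit: "row_bit E lin v"
  shows "row_bit E' lin' v"
proof -
  obtain S where S: "v \<in> S" "\<And>x. x \<in> S \<Longrightarrow> node_ok E lin x" "\<And>x. x \<in> S \<Longrightarrow> reach_le E (2 * M) v x"
    "\<And>x y. x \<in> S \<Longrightarrow> E x y \<Longrightarrow> lin x y \<noteq> 6 \<Longrightarrow> y \<in> S"
    using error_free_component[OF v noerr M] by blast
  obtain y z where yz: "(\<lambda>x x'. x' \<in> nxt E lin x)\<^sup>*\<^sup>* y v" "prv E lin y = {}" "E y z" "lin y z = 4"
    using bit by (auto simp: row_bit_def)
  from yz(1) have "y \<in> S \<and> (\<lambda>x x'. x' \<in> nxt E' lin' x)\<^sup>*\<^sup>* y v"
  proof (induction rule: converse_rtranclp_induct)
    case base
    then show ?case using S(1) by simp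
  next
    case (step x x')
    then have "x' \<in> S" by simp
    then have "x \<in> prv E lin x'" using nxt_prv' S(2) step.hyps(1) by blast
    then have "x \<in> S" using S(4)[OF \<open>x' \<in> S\<close>, of x] by (simp add: port_def)
    then have "x' \<in> nxt E' lin' x"
      using agree_at_port[OF agree[OF S(3)]] step.hyps(1) by blast
    then show ?case using \<open>x \<in> S\<close> step.IH by (meson converse_rtranclp_into_rtranclp)
  qed
  moreover from this have y: "agree_at E lin E' lin' y" using agree S(3) by blast
  moreover have "prv E' lin' y = {}" using agree_at_port[OF y] yz(2) by simp
  moreover have "E' y z" "lin' y z = 4" using y yz by (simp_all add: agree_at_def)
  ultimately show ?thesis unfolding row_bit_def by blast
qed

end

text \<open>\<open>k\<close> may exceed \<open>T\<close> by one, since agreement at a node of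
  distance \<open>T\<close> includes the edges leaving it.\<close>

lemma agree_at_reach:
  assumes "\<And>x. reach_le E T v x \<Longrightarrow> agree_at E lin E' lin' x" "k \<le> Suc T"
  shows "reach_le E k v x \<longleftrightarrow> reach_le E' k v x"
  using assms(2)
proof (induction k arbitrary: x)
  case (Suc k)
  have step: "E y x \<longleftrightarrow> E' y x" if "reach_le E k v y" for y
    using assms(1)[OF reach_le_mono[OF that]] Suc.prems by (simp add: agree_at_def)
  have IH: "reach_le E k v y \<longleftrightarrow> reach_le E' k v y" for y using Suc by simp
  have snoc: "reach_le F (Suc k) v x \<longleftrightarrow> reach_le F k v x \<or> (\<exists>y. reach_le F k v y \<and> F y x)" for F
    using reach_le_snocD[of F k v x] reach_le_mono[of F k v x "Suc k"]
      reach_le_trans[of F k v _ "Suc 0" x] reach_le_edge[of F _ x]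
    by (metis Suc_n_not_le_n add_Suc_right add.right_neutral nat_le_linear)
  show ?case unfolding snoc using IH step by auto
qed simp

lemma node_label_cong:
  assumes G: "simple_graph V E" "v \<in> V" "card V < 2 ^ M"
    and G': "simple_graph V' E'" "v \<in> V'" "card V' < 2 ^ M"
    and agree: "\<And>x. reach_le E (2 * M + 1) v x \<Longrightarrow> agree_at E lin E' lin' x"
  shows "node_label E' lin' M v = node_label E lin M v"
proof -
  interpret A: agreeing_graphs V E lin E' lin' by unfold_locales (rule G(1))
  interpret B: agreeing_graphs V' E' lin' E lin by unfold_locales (rule G'(1))
  have agree_le: "agree_at E lin E' lin' x" if "reach_le E k v x" "k \<le> 2 * M + 1" for x k
    using agree reach_le_mono that by blast
  have agree': "agree_at E' lin' E lin x" if "reach_le E' (2 * M) v x" for x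
  proof -
    have "reach_le E (2 * M) v x \<longleftrightarrow> reach_le E' (2 * M) v x"
      by (rule agree_at_reach[where T = "2 * M + 1", OF agree]) (assumption, simp)
    then have "agree_at E lin E' lin' x" using agree_le that by simp
    then show ?thesis by (simp add: agree_at_def)
  qed
  have ok: "node_ok E' lin' v \<longleftrightarrow> node_ok E lin v"
    by (intro A.node_ok_cong agree_le[of "Suc 0"]) simp_all
  have below: "err_below E' lin' M v \<longleftrightarrow> err_below E lin M v"
    by (intro A.err_below_cong agree_le[of "Suc M"]) simp_all
  have seen: "err_seen E' lin' M M v \<longleftrightarrow> err_seen E lin M M v"
    by (intro A.err_seen_cong agree_le[of "M + Suc M"]) simp_all
  have bit: "row_bit E' lin' v \<longleftrightarrow> row_bit E lin v" if "\<not> err_seen E lin M M v"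
    using A.row_bit_transfer[OF G(2) that G(3)] B.row_bit_transfer[OF G'(2) _ G'(3)] agree_le[of "2 * M"]
      agree' that seen by auto
  show ?thesis unfolding node_label_def ok below seen using bit by auto
qed

section \<open>Gathering a neighbourhood by flooding\<close>

definition knowledge ::
  "(nat \<Rightarrow> nat \<Rightarrow> bool) \<Rightarrow> (nat \<Rightarrow> nat \<Rightarrow> nat) \<Rightarrow> nat \<Rightarrow> nat \<Rightarrow> (nat \<times> nat \<times> nat) set" where
  "knowledge E lin t v = {(x, y, l). reach_le E t v x \<and> E x y \<and> l = lin x y}"

text \<open>A node reached in both graphs has the same edges and labels in both, so the ball of the
  first graph is rebuilt inside the second one step at a time.\<close>

lemma knowledge_agree:
  assumes K: "knowledge E' lin' T v = knowledge E lin T v" and x: "reach_le E T v x"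
  shows "agree_at E lin E' lin' x"
proof -
  have mem: "reach_le E' T v x \<and> E' x y \<and> l = lin' x y \<longleftrightarrow> reach_le E T v x \<and> E x y \<and> l = lin x y" for x y l
    using K by (auto simp: knowledge_def set_eq_iff)
  have agree: "agree_at E lin E' lin' x" if "reach_le E T v x" "reach_le E' T v x" for x
    using mem[of x] that unfolding agree_at_def by blast
  have "reach_le E' k v x" if "reach_le E k v x" "k \<le> T" for k x
    using that
  proof (induction k arbitrary: x)
    case (Suc k)
    from reach_le_snocD[OF Suc.prems(1)] show ?case
    proof (elim disjE exE conjE)
      assume "reach_le E k v x"
      then show ?thesis using Suc.IH Suc.prems(2) reach_le_mono[of E' k v x "Suc k"] by simp
    next
      fix y assume y: "reach_le E k v y" "E y x"
      then have y': "reach_le E' k v y" using Suc.IH Suc.prems(2) by simp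
      have "agree_at E lin E' lin' y"
        using agree reach_le_mono[OF y(1)] reach_le_mono[OF y'] Suc.prems(2) by simp
      then have "E' y x" using y(2) by (simp add: agree_at_def)
      then show ?thesis using reach_le_trans[OF y' reach_le_edge] by simp
    qed
  qed simp
  then show ?thesis using agree x by blast
qed

text \<open>LOCAL messages may be arbitrarily long, so the number coding the identifier and the
  known half-edges is written in unary; the length of the string carries everything.\<close>

definition encode :: "nat \<Rightarrow> (nat \<times> nat \<times> nat) set \<Rightarrow> bool list" where
  "encode v K = replicate (to_nat (v, set_encode (to_nat ` K))) True"

definition decode_id :: "bool list \<Rightarrow> nat" where
  "decode_id s = fst (from_nat (length s) :: nat \<times> nat)"

definition decode_set :: "bool list \<Rightarrow> (nat \<times> nat \<times> nat) set" where
  "decode_set s = from_nat ` set_decode (snd (from_nat (length s) :: nat \<times> nat))"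

lemma decode_encode:
  "decode_id (encode v K) = v" "finite K \<Longrightarrow> decode_set (encode v K) = K"
  by (simp_all add: encode_def decode_id_def decode_set_def image_image)

definition gather_alg :: "(nat \<Rightarrow> nat \<Rightarrow> (nat \<times> nat \<times> nat) set \<Rightarrow> nat) \<Rightarrow> alg" where
  "gather_alg f = Alg
     (\<lambda>n v ins \<rho>. encode v {(x, y, l). x = v \<and> ins y = Some l})
     (\<lambda>n s u. s)
     (\<lambda>n s msgs. encode (decode_id s) (decode_set s \<union> (\<Union>m\<in>ran msgs. decode_set m)))
     (\<lambda>n s u. f n (decode_id s) (decode_set s))
     (\<lambda>n. 0)"

lemma gather_alg_simps:
  "a_init (gather_alg f) n v ins bs = encode v {(x, y, l). x = v \<and> ins y = Some l}"
  "a_send (gather_alg f) n s u = s"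
  "a_recv (gather_alg f) n s msgs =
     encode (decode_id s) (decode_set s \<union> (\<Union>m\<in>ran msgs. decode_set m))"
  "a_out (gather_alg f) n s u = f n (decode_id s) (decode_set s)"
  "a_bits (gather_alg f) n = 0"
  by (simp_all add: gather_alg_def)

lemma finite_knowledge:
  assumes "simple_graph V E"
  shows "finite (knowledge E lin t v)"
proof -
  have "knowledge E lin t v \<subseteq> (\<lambda>(x, y). (x, y, lin x y)) ` (V \<times> V)"
    using assms by (auto simp: knowledge_def simple_graph_def)
  then show ?thesis using assms by (auto simp: simple_graph_def intro: finite_subset)
qed

lemma knowledge_Suc:
  "knowledge E lin (Suc t) v = knowledge E lin t v \<union> (\<Union>u\<in>{u. E v u}. knowledge E lin t u)"
  using reach_le_mono[of E t v _ "Suc t"] by (auto simp: knowledge_def)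

lemma run_gather_alg:
  assumes "simple_graph V E"
  shows "run (gather_alg f) n E lin \<rho> t v = encode v (knowledge E lin t v)"
proof (induction t arbitrary: v)
  case 0
  have "{(x, y, l). x = v \<and> (if E v y then Some (lin v y) else None) = Some l} =
      knowledge E lin 0 v"
    by (auto simp: knowledge_def split: if_splits)
  then show ?case by (simp only: run.simps gather_alg_simps)
next
  case (Suc t)
  have ran: "ran (\<lambda>u. if E v u then Some (encode u (knowledge E lin t u)) else None) =
      (\<lambda>u. encode u (knowledge E lin t u)) ` {u. E v u}"
    by (auto simp: ran_def)
  show ?case
    unfolding run.simps gather_alg_simps Suc ran knowledge_Suc
    using finite_knowledge[OF assms] by (simp add: decode_encode)
qed

text \<open>All instances with the same knowledge lead to the same label
  (\<open>node_label_cong\<close>), so that an arbitrary one may be chosen.\<close>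

definition shortcut_output :: "nat \<Rightarrow> nat \<Rightarrow> nat \<Rightarrow> (nat \<times> nat \<times> nat) set \<Rightarrow> nat" where
  "shortcut_output c n v K =
     (let M = floorlog 2 n; (V, E, lin) = (SOME (V, E, lin). lcl_instance shortcut_lcl 7 c n V E lin \<and>
        v \<in> V \<and> knowledge E lin (2 * M + 1) v = K)
      in node_label E lin M v)"

lemma shortcut_output_knowledge:
  assumes inst: "lcl_instance shortcut_lcl 7 c n V E lin" and v: "v \<in> V"
  shows "shortcut_output c n v (knowledge E lin (2 * floorlog 2 n + 1) v) =
    node_label E lin (floorlog 2 n) v"
proof -
  define M where "M = floorlog 2 n"
  define P where "P = (\<lambda>(V', E', lin'). lcl_instance shortcut_lcl 7 c n V' E' lin' \<and>
    v \<in> V' \<and> knowledge E' lin' (2 * M + 1) v = knowledge E lin (2 * M + 1) v)"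
  have "P (V, E, lin)" using assms by (simp add: P_def)
  then have "P (Eps P)" by (rule someI)
  moreover obtain V' E' lin' where eq: "Eps P = (V', E', lin')" by (cases "Eps P")
  ultimately have inst': "lcl_instance shortcut_lcl 7 c n V' E' lin'" and v': "v \<in> V'"
    and K: "knowledge E' lin' (2 * M + 1) v = knowledge E lin (2 * M + 1) v"
    by (simp_all add: P_def)
  have n: "0 < n" using inst v by (auto simp: lcl_instance_def simple_graph_def card_gt_0_iff)
  then have nM: "n < 2 ^ M" using floorlog_bounds[of n 2] by (simp add: M_def)
  have "node_label E' lin' M v = node_label E lin M v"
  proof (rule node_label_cong[where V = V and V' = V'])
    show "agree_at E lin E' lin' x" if "reach_le E (2 * M + 1) v x" for x
      using knowledge_agree[OF K that] .
  qed (use inst inst' v v' nM in \<open>auto simp: lcl_instance_def\<close>)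
  moreover have "shortcut_output c n v (knowledge E lin (2 * M + 1) v) =
      (case Eps P of (V, E, lin) \<Rightarrow> node_label E lin M v)"
    by (simp add: shortcut_output_def Let_def P_def flip: M_def)
  ultimately show ?thesis by (simp add: eq M_def)
qed

lemma det_solves_shortcut:
  "det_solves shortcut_lcl 7 c (gather_alg (shortcut_output c)) (\<lambda>n. 2 * floorlog 2 n + 1)"
  unfolding det_solves_def
proof (intro conjI allI impI)
  fix n show "a_bits (gather_alg (shortcut_output c)) n = 0" by (simp add: gather_alg_simps)
next
  fix n V E lin assume inst: "lcl_instance shortcut_lcl 7 c n V E lin"
  have G: "simple_graph V E" using inst by (simp add: lcl_instance_def)
  then interpret labelled_graph V E lin by unfold_locales
  let ?M = "floorlog 2 n"
  let ?out = "alg_output (gather_alg (shortcut_output c)) n E lin (\<lambda>_. []) (2 * ?M + 1)"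
  have out: "?out v u = node_label E lin ?M v" if "v \<in> V" for v u
    using shortcut_output_knowledge[OF inst that] finite_knowledge[OF G]
    by (simp only: alg_output_def run_gather_alg[OF G]) (simp add: gather_alg_simps decode_encode)
  have "loc_valid E lin ?out v" if v: "v \<in> V" for v
  proof -
    \<comment> \<open>The output agrees with \<open>node_label\<close> only on \<open>V\<close>;
      invariance under the identity map exchanges the two in the rules at \<open>v\<close>.\<close>
    interpret N: neighbourhood_map id UNIV "insert v {y. E v y}" v E E lin lin
      by unfold_locales (auto simp: edge_sym)
    have "loc_valid E lin ?out (id v) \<longleftrightarrow> loc_valid E lin (\<lambda>v u. node_label E lin ?M v) v"
      using out edge_V v by (intro N.loc_valid_iff) auto
    then show ?thesis using loc_valid_node_label by simp
  qed
  moreover have "?out u w \<le> 4" if "E u w" for u w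
    using out edge_V[OF that] node_label_le by simp
  ultimately show "lcl_valid shortcut_lcl V E lin ?out"
    using shortcut_lcl_valid_iff[OF inst] by blast
qed

lemma floorlog_bigo: "(\<lambda>n. real (2 * floorlog 2 n + 1)) \<in> O(\<lambda>n. ln (real n))"
\<comment> \<open>For L = log 2 n at least 1, 2(L + 1) + 1 \<le> 5L.\<close>
proof (rule bigoI[where c = "5 / ln 2"])
  show "\<forall>\<^sub>F n in at_top. norm (real (2 * floorlog 2 n + 1)) \<le> 5 / ln 2 * norm (ln (real n))"
    using eventually_ge_at_top[of 2]
  proof eventually_elim
    case (elim n)
    have "floorlog 2 n = nat \<lfloor>log 2 (real n)\<rfloor> + 1" using elim by (simp add: floorlog_def)
    moreover have log: "1 \<le> log 2 (real n)" using elim by simp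
    ultimately have "real (floorlog 2 n) \<le> log 2 (real n) + 1" by linarith
    then have "real (2 * floorlog 2 n + 1) \<le> 5 * log 2 (real n)" using log by simp
    also have "\<dots> = 5 / ln 2 * norm (ln (real n))" using elim by (simp add: log_def)
    finally show ?case by simp
  qed
qed

section \<open>Grids with shortcut trees\<close>

abbreviation lev :: "nat \<Rightarrow> nat" where "lev \<equiv> floor_log"

declare floor_log.simps [simp del]

lemma lev_bounds: "1 \<le> x \<Longrightarrow> 2 ^ lev x \<le> x" "x < 2 * 2 ^ lev x"
  using floor_log_exp2_le floor_log_exp2_gt by auto

lemma lev_eqI: "2 ^ k \<le> x \<Longrightarrow> x < 2 * 2 ^ k \<Longrightarrow> lev x = k"
  by (rule floor_log_eqI) (auto intro: order.strict_trans1[of 0] less_le_trans[of 0 "2 ^ k"])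

lemma lev_double: "1 \<le> x \<Longrightarrow> lev (2 * x) = Suc (lev x)" "1 \<le> x \<Longrightarrow> lev (Suc (2 * x)) = Suc (lev x)"
  using lev_bounds[of x] by (auto intro!: lev_eqI)

lemma lev_pos: "2 \<le> x \<Longrightarrow> 1 \<le> lev x"
  using floor_log_rec[of x] by linarith

lemma lev_less_iff: "1 \<le> x \<Longrightarrow> lev x < k \<longleftrightarrow> x < 2 ^ k"
proof
  assume "lev x < k"
  then have "2 * 2 ^ lev x \<le> (2::nat) ^ k"
    by (metis Suc_leI power_Suc power_increasing one_le_numeral)
  then show "x < 2 ^ k" using lev_bounds(2)[of x] by simp
next
  assume "1 \<le> x" "x < 2 ^ k"
  then have "(2::nat) ^ lev x < 2 ^ k" using lev_bounds(1)[of x] by linarith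
  then show "lev x < k" by simp
qed

text \<open>Nodes are numbered as in a binary heap, with root 1. The levels up to \<open>s\<close> form the tree over the
  columns; a node of level \<open>s + k\<close> lies in column \<open>x div 2 ^ k\<close>, so that a row continues
  \<open>2 ^ k\<close> places further right in the same level. Node 0 and the nodes from \<open>2 ^ (2 * s + 1)\<close> on are
  padding, attached as in the heap.\<close>

definition side_step :: "nat \<Rightarrow> nat \<Rightarrow> bool" where
  "side_step x y \<longleftrightarrow> 1 \<le> x \<and> lev y = lev x \<and> y = Suc x"

definition row_step :: "nat \<Rightarrow> nat \<Rightarrow> nat \<Rightarrow> bool" where
  "row_step s x y \<longleftrightarrow> s < lev x \<and> lev y = lev x \<and> y = x + 2 ^ (lev x - s)"

definition lateral :: "nat \<Rightarrow> nat \<Rightarrow> nat \<Rightarrow> bool" where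
  "lateral s x y \<longleftrightarrow> side_step x y \<or> side_step y x \<or> row_step s x y \<or> row_step s y x"

definition heap_step :: "nat \<Rightarrow> nat \<Rightarrow> bool" where
  "heap_step x y \<longleftrightarrow> 1 \<le> y \<and> x = y div 2"

definition heap_edge :: "nat \<Rightarrow> nat \<Rightarrow> nat \<Rightarrow> nat \<Rightarrow> bool" where
  "heap_edge s n x y \<longleftrightarrow> x < n \<and> y < n \<and> (heap_step x y \<or> heap_step y x \<or>
     lateral s x y \<and> x < 2 ^ (2 * s + 1) \<and> y < 2 ^ (2 * s + 1))"

text \<open>\<open>W\<close> is the set of rows with bit 1. Row \<open>i\<close> starts at the leaf
  2^(2s) + i, so for \<open>W\<close> within \<open>{..<2 ^ s}\<close> the label 4 occurs only at
  row starts; rows on intermediate levels carry only 3.\<close>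

definition heap_in :: "nat \<Rightarrow> nat set \<Rightarrow> nat \<Rightarrow> nat \<Rightarrow> nat" where
  "heap_in s W x y =
     (if heap_step y x then if 2 \<le> x \<and> x < 2 ^ (2 * s + 1) then 0 else 6
      else if heap_step x y then if 2 \<le> y \<and> y < 2 ^ (2 * s + 1) then 1 else 6
      else if row_step s x y then if lev x = 2 * s \<and> x - 2 ^ (2 * s) \<in> W then 4 else 3
      else if row_step s y x then 5 else 2)"

lemma lateral_sym: "lateral s x y \<longleftrightarrow> lateral s y x"
  by (auto simp: lateral_def)

text \<open>Rows exist strictly below the column roots only, where a column has at least two nodes
  per level. So a row step is never a side step as well, and each edge has one label.\<close>

lemma row_step_gt: "row_step s x y \<Longrightarrow> Suc (Suc x) \<le> y \<and> 2 \<le> x"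
proof -
  assume row: "row_step s x y"
  then obtain k where "lev x - s = Suc k" by (metis Suc_diff_Suc row_step_def)
  then have "y = x + 2 * 2 ^ k" using row by (simp add: row_step_def)
  moreover have "2 \<le> x"
    using row lev_less_iff[of x 1] by (cases "x = 0") (auto simp: row_step_def)
  ultimately show ?thesis by simp
qed

lemma lateral_lev: "lateral s x y \<Longrightarrow> lev y = lev x \<and> 1 \<le> x \<and> 1 \<le> y"
  using row_step_gt[of s x y] row_step_gt[of s y x]
  by (auto simp: lateral_def side_step_def row_step_def)

lemma lateral_two_le:
  assumes "lateral s x y" shows "2 \<le> x"
proof (rule ccontr)
  assume "\<not> 2 \<le> x"
  then have x: "x = 1" using lateral_lev[OF assms] by simp
  then have "y = 1" using lateral_lev[OF assms] lev_less_iff[of y 1] by simp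
  then show False using assms x row_step_gt[of s 1 1] by (auto simp: lateral_def side_step_def)
qed

lemma lateral_not_heap_step:
  assumes "lateral s x y" shows "\<not> heap_step x y"
proof
  assume "heap_step x y"
  then have "lev x = lev y - 1" by (simp add: heap_step_def)
  moreover have "1 \<le> lev y"
    using assms lateral_sym by (intro lev_pos lateral_two_le[of s y x]) blast
  ultimately show False using lateral_lev[OF assms] by simp
qed

lemma heap_step_asym: "heap_step x y \<Longrightarrow> \<not> heap_step y x"
  by (auto simp: heap_step_def)

lemma row_not_row: "row_step s x y \<Longrightarrow> \<not> row_step s y x"
  using row_step_gt[of s x y] row_step_gt[of s y x] by auto

text \<open>Halving maps a side step to equality or a side step, and a row step to a row step one
  level up; on the level just below the column roots it becomes a side step between columns.\<close>

lemma lateral_half: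
  assumes "lateral s x z"
  shows "x div 2 = z div 2 \<or> lateral s (x div 2) (z div 2)"
proof -
  have half: "x div 2 = z div 2 \<or> lateral s (x div 2) (z div 2)"
    if "side_step x z \<or> row_step s x z" for x z
  proof -
    have lat: "lateral s x z" using that by (auto simp: lateral_def)
    have lev: "lev (z div 2) = lev (x div 2)" using lateral_lev[OF lat] by simp
    have two: "2 \<le> x" using lat by (rule lateral_two_le)
    then have pos: "1 \<le> x div 2" by linarith
    have side: "lateral s (x div 2) (z div 2)" if "z div 2 = Suc (x div 2)"
      using that lev pos by (simp add: lateral_def side_step_def)
    from that show ?thesis
    proof
      assume "side_step x z"
      then have "z div 2 = x div 2 \<or> z div 2 = Suc (x div 2)" by (auto simp: side_step_def)
      then show ?thesis using side by auto
    next
      assume row: "row_step s x z"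
      then obtain k where k: "lev x - s = Suc k" by (metis Suc_diff_Suc row_step_def)
      then have z: "z div 2 = x div 2 + 2 ^ k" using row by (simp add: row_step_def)
      show ?thesis
      proof (cases k)
        case 0
        then show ?thesis using z side by simp
      next
        case (Suc k')
        have "s < lev (x div 2)" "lev (x div 2) - s = k" using k Suc by simp_all
        then have "row_step s (x div 2) (z div 2)"
          using z lev by (simp only: row_step_def)
        then show ?thesis by (simp add: lateral_def)
      qed
    qed
  qed
  show ?thesis
    using half[of x z] half[of z x] assms lateral_sym by (metis lateral_def)
qed

lemma lateral_double:
  assumes "lateral s x z"
  shows "\<exists>y\<in>{2 * x, Suc (2 * x)}. \<exists>y'\<in>{2 * z, Suc (2 * z)}. lateral s y y'"
proof -
  have double: "\<exists>y\<in>{2 * x, Suc (2 * x)}. \<exists>y'\<in>{2 * z, Suc (2 * z)}. lateral s y y'"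
    if "side_step x z \<or> row_step s x z" for x z
  proof -
    have lat: "lateral s x z" using that by (auto simp: lateral_def)
    have lev: "lev z = lev x" "1 \<le> x" "1 \<le> z" using lateral_lev[OF lat] by auto
    from that show ?thesis
    proof
      assume "side_step x z"
      then have "side_step (Suc (2 * x)) (2 * z)"
        using lev lev_double[of x] lev_double[of z] by (simp add: side_step_def)
      then show ?thesis by (auto simp: lateral_def)
    next
      assume row: "row_step s x z"
      then obtain k where k: "lev x - s = Suc k" by (metis Suc_diff_Suc row_step_def)
      have "row_step s (2 * x) (2 * z)"
        using row lev lev_double[of x] lev_double[of z] k by (auto simp: row_step_def Suc_diff_le)
      then show ?thesis by (auto simp: lateral_def)
    qed
  qed
  show ?thesis
  proof (cases "side_step x z \<or> row_step s x z")
    case False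
    then have "side_step z x \<or> row_step s z x" using assms by (auto simp: lateral_def)
    then show ?thesis using double[of z x] lateral_sym by blast
  qed (rule double)
qed

section \<open>The grid instances and their solutions\<close>

locale heap_graph =
  fixes s n :: nat and W :: "nat set"
  assumes s: "1 \<le> s" and n: "2 ^ (2 * s + 1) \<le> n"
begin

abbreviation "N \<equiv> (2::nat) ^ (2 * s + 1)"
abbreviation "E \<equiv> heap_edge s n"
abbreviation "lin \<equiv> heap_in s W"

lemma tree_lev: "1 \<le> x \<Longrightarrow> x < N \<longleftrightarrow> lev x \<le> 2 * s"
  using lev_less_iff[of x "2 * s + 1"] by auto

lemma lateral_N: "lateral s x y \<Longrightarrow> x < N \<longleftrightarrow> y < N"
  using lateral_lev[of s x y] tree_lev[of x] tree_lev[of y] by auto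

lemma E_sym: "E x y \<Longrightarrow> E y x"
  by (auto simp: heap_edge_def lateral_sym)

lemma heap_in_down: "heap_step x y \<Longrightarrow> lin x y = (if 2 \<le> y \<and> y < N then 1 else 6)"
  and heap_in_up: "heap_step x y \<Longrightarrow> lin y x = (if 2 \<le> y \<and> y < N then 0 else 6)"
  using heap_step_asym[of x y] by (simp_all add: heap_in_def)

lemma heap_in_lateral:
  assumes "lateral s x y"
  shows "lin x y = (if row_step s x y then if lev x = 2 * s \<and> x - 2 ^ (2 * s) \<in> W then 4 else 3
      else if row_step s y x then 5 else 2)"
  using lateral_not_heap_step[OF assms] lateral_not_heap_step[of s y x] assms lateral_sym
  by (auto simp: heap_in_def)

lemma edge_cases:
  assumes "E x y"
  obtains "heap_step x y" | "heap_step y x" | "lateral s x y"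
  using assms by (auto simp: heap_edge_def)

lemma heap_pairing: "E x y \<Longrightarrow> (lin x y, lin y x) \<in> port_pairs"
proof (erule edge_cases)
  assume lat: "lateral s x y"
  then have lat': "lateral s y x" using lateral_sym by blast
  show ?thesis
    unfolding heap_in_lateral[OF lat] heap_in_lateral[OF lat']
    using row_not_row[of s x y] by (auto simp: port_pairs_def)
qed (auto simp: heap_in_down heap_in_up port_pairs_def)

lemma par_iff:
  assumes "1 \<le> x" "x < N"
  shows "y \<in> par E lin x \<longleftrightarrow> 2 \<le> x \<and> y = x div 2"
proof
  assume "y \<in> par E lin x"
  then have "E x y" "lin x y = 0" by (auto simp: port_def)
  then show "2 \<le> x \<and> y = x div 2"
    by (cases rule: edge_cases)
      (auto simp: heap_in_down heap_in_up heap_in_lateral heap_step_def split: if_splits)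
next
  assume y: "2 \<le> x \<and> y = x div 2"
  then have "heap_step y x" by (simp add: heap_step_def)
  then show "y \<in> par E lin x"
    using y assms n by (auto simp: port_def heap_edge_def heap_in_up)
qed

lemma chi_iff:
  assumes "1 \<le> x" "x < N"
  shows "y \<in> chi E lin x \<longleftrightarrow> lev x < 2 * s \<and> y \<in> {2 * x, Suc (2 * x)}"
proof
  assume "y \<in> chi E lin x"
  then have "E x y" "lin x y = 1" by (auto simp: port_def)
  then have y: "heap_step x y" "y < N"
    by (cases rule: edge_cases; auto simp: heap_in_down heap_in_up heap_in_lateral split: if_splits)+
  then have "y \<in> {2 * x, Suc (2 * x)}" by (auto simp: heap_step_def)
  moreover from this have "lev y = Suc (lev x)" using lev_double assms by auto
  ultimately show "lev x < 2 * s \<and> y \<in> {2 * x, Suc (2 * x)}" using y tree_lev[of y] assms by auto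
next
  assume y: "lev x < 2 * s \<and> y \<in> {2 * x, Suc (2 * x)}"
  then have "lev y \<le> 2 * s" using lev_double[of x] assms by auto
  then have "y < N" using tree_lev[of y] y assms by auto
  moreover have step: "heap_step x y" using y assms by (auto simp: heap_step_def)
  ultimately show "y \<in> chi E lin x"
    using y assms n by (auto simp: port_def heap_edge_def heap_in_down)
qed

lemma lat_iff:
  assumes "1 \<le> x" "x < N"
  shows "y \<in> lat E lin x \<longleftrightarrow> lateral s x y"
proof
  assume "y \<in> lat E lin x"
  then have "E x y" "lin x y \<in> {2,3,4,5}" by (auto simp: port_def)
  then show "lateral s x y"
    by (cases rule: edge_cases) (auto simp: heap_in_down heap_in_up split: if_splits)
next
  assume lat: "lateral s x y"
  then have "E x y" using lateral_N[OF lat] assms n by (auto simp: heap_edge_def)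
  then show "y \<in> lat E lin x" by (auto simp: port_def heap_in_lateral[OF lat])
qed

lemma nxt_iff:
  assumes "1 \<le> x" "x < N"
  shows "y \<in> nxt E lin x \<longleftrightarrow> row_step s x y"
proof -
  have "y \<in> nxt E lin x \<longleftrightarrow> y \<in> lat E lin x \<and> lin x y \<in> {3,4}" by (auto simp: port_def)
  moreover have "lin x y \<in> {3,4} \<longleftrightarrow> row_step s x y" if "lateral s x y"
    unfolding heap_in_lateral[OF that] by simp
  moreover have "row_step s x y \<Longrightarrow> lateral s x y" by (simp add: lateral_def)
  ultimately show ?thesis unfolding lat_iff[OF assms] by blast
qed

lemma prv_iff:
  assumes "1 \<le> x" "x < N"
  shows "y \<in> prv E lin x \<longleftrightarrow> row_step s y x"
proof -
  have "y \<in> prv E lin x \<longleftrightarrow> y \<in> lat E lin x \<and> lin x y = 5" by (auto simp: port_def)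
  moreover have "lin x y = 5 \<longleftrightarrow> row_step s y x" if "lateral s x y"
    unfolding heap_in_lateral[OF that] using row_not_row[of s y x] by simp
  moreover have "row_step s y x \<Longrightarrow> lateral s x y" by (simp add: lateral_def)
  ultimately show ?thesis unfolding lat_iff[OF assms] by blast
qed

text \<open>Only tree nodes are covered: label 6 belongs to no port, so no pointer of a tree node
  can lead to padding.\<close>

lemma heap_node_ok:
  assumes x: "1 \<le> x" "x < N"
  shows "node_ok E lin x"
  unfolding node_ok_def
proof (intro conjI ballI)
  fix y assume "y \<in> {y. E x y}"
  then show "(lin x y, lin y x) \<in> port_pairs" using heap_pairing by simp
next
  fix y z assume "y \<in> par E lin x" "z \<in> par E lin x"
  then show "y = z" by (simp add: par_iff[OF x])
next
  fix y z assume "y \<in> nxt E lin x" "z \<in> nxt E lin x"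
  then show "y = z" by (simp add: nxt_iff[OF x] row_step_def)
next
  fix y z assume "y \<in> prv E lin x" "z \<in> prv E lin x"
  then show "y = z" unfolding prv_iff[OF x] row_step_def by auto
next
  fix y assume y: "y \<in> chi E lin x"
  then have lev: "lev x < 2 * s" by (simp only: chi_iff[OF x])
  have tree: "1 \<le> w \<and> w < N" if "w \<in> {2 * x, Suc (2 * x)}" for w
    using that lev lev_double[of x] x tree_lev[of w] by auto
  have side: "side_step (2 * x) (Suc (2 * x))"
    using x lev_double[of x] by (simp add: side_step_def)
  from y consider "y = 2 * x" | "y = Suc (2 * x)" by (auto simp only: chi_iff[OF x])
  then show "\<exists>z\<in>chi E lin x. z \<noteq> y \<and> z \<in> lat E lin y \<and> (\<forall>u\<in>chi E lin x. u = y \<or> u = z)"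
  proof cases
    case 1
    then have "Suc (2 * x) \<in> lat E lin y" using tree[of y] side by (subst lat_iff) (auto simp: lateral_def)
    then show ?thesis using 1 lev by (intro bexI[of _ "Suc (2 * x)"]) (auto simp only: chi_iff[OF x])
  next
    case 2
    then have "2 * x \<in> lat E lin y" using tree[of y] side by (subst lat_iff) (auto simp: lateral_def)
    then show ?thesis using 2 lev by (intro bexI[of _ "2 * x"]) (auto simp only: chi_iff[OF x])
  qed
next
  fix z assume "z \<in> lat E lin x"
  then have lat: "lateral s x z" by (simp only: lat_iff[OF x])
  have z: "1 \<le> z" "z < N" "lev z = lev x" using lateral_lev[OF lat] lateral_N[OF lat] x by auto
  have two: "2 \<le> x" "2 \<le> z" using lateral_two_le lat lateral_sym by blast+
  have half: "1 \<le> x div 2" "x div 2 < N" using two(1) x by auto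
  show "\<exists>p\<in>par E lin x. \<exists>q\<in>par E lin z. p = q \<or> q \<in> lat E lin p"
    using lateral_half[OF lat] two
    by (intro bexI[of _ "x div 2"] bexI[of _ "z div 2"])
      (auto simp only: lat_iff[OF half] par_iff[OF x] par_iff[OF z(1,2)])
  show "chi E lin x = {} \<longleftrightarrow> chi E lin z = {}"
    unfolding set_eq_iff chi_iff[OF x] chi_iff[OF z(1,2)] z(3) by auto
  show "chi E lin x \<noteq> {} \<longrightarrow> (\<exists>y\<in>chi E lin x. \<exists>y'\<in>chi E lin z. y' \<in> lat E lin y)"
  proof
    assume "chi E lin x \<noteq> {}"
    then obtain w where "w \<in> chi E lin x" by blast
    then have lev: "lev x < 2 * s" by (simp only: chi_iff[OF x])
    obtain y y' where y: "y \<in> {2 * x, Suc (2 * x)}" "y' \<in> {2 * z, Suc (2 * z)}" "lateral s y y'"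
      using lateral_double[OF lat] by blast
    then have "y \<in> chi E lin x" "y' \<in> chi E lin z"
      unfolding chi_iff[OF x] chi_iff[OF z(1,2)] using lev z(3) by auto
    moreover have "1 \<le> y" "y < N" using y(1) lev lev_double[of x] x tree_lev[of y] by auto
    then have "y' \<in> lat E lin y" using y(3) lat_iff by blast
    ultimately show "\<exists>y\<in>chi E lin x. \<exists>y'\<in>chi E lin z. y' \<in> lat E lin y" by blast
  qed
qed

lemma E_parent: "1 \<le> x \<Longrightarrow> x < n \<Longrightarrow> E x (x div 2)"
  by (auto simp: heap_edge_def heap_step_def)

lemma reach_root: "x < n \<Longrightarrow> reach_le E x x 0"
proof (induction x rule: less_induct)
  case (less x)
  show ?case
  proof (cases "x = 0")
    case False
    then obtain k where k: "x = Suc k" by (cases x) auto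
    have "reach_le E (x div 2) (x div 2) 0" using less False by simp
    then have "reach_le E k (x div 2) 0" using k by (elim reach_le_mono) simp
    then show ?thesis using E_parent[of x] less.prems k by auto
  qed simp
qed

lemma heap_instance:
  assumes "1 \<le> c"
  shows "lcl_instance shortcut_lcl 7 c n {..<n} E lin"
  unfolding lcl_instance_def
proof (intro conjI)
  show "simple_graph {..<n} E"
    unfolding simple_graph_def
  proof (intro conjI allI impI)
    fix u w assume uw: "E u w"
    then show "u \<in> {..<n}" "w \<in> {..<n}" by (auto simp: heap_edge_def)
    show "E w u" using uw by (rule E_sym)
    show "u \<noteq> w" using uw
    proof (cases rule: edge_cases)
      case 3
      then show ?thesis
        using row_step_gt[of s u w] row_step_gt[of s w u] by (auto simp: lateral_def side_step_def)
    qed (auto simp: heap_step_def)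
  qed simp
  show "connected_graph {..<n} E"
    unfolding connected_graph_def
  proof (intro ballI)
    fix u w assume "u \<in> {..<n}" "w \<in> {..<n}"
    then have "reach_le E u u 0" "reach_le E w 0 w"
      using reach_root reach_le_sym[OF E_sym reach_root] by auto
    then show "\<exists>k. reach_le E k u w" using reach_le_trans by blast
  qed
  show "max_degree_le {..<n} E 7"
    unfolding max_degree_le_def
  proof
    fix v assume "v \<in> {..<n}"
    \<comment> \<open>These are the parent, two children, two side neighbours and two row
      neighbours: the source of the degree bound 7.\<close>
    let ?xs = "[v div 2, 2 * v, Suc (2 * v), Suc v, v - 1, v + 2 ^ (lev v - s), v - 2 ^ (lev v - s)]"
    have "u \<in> set ?xs" if "E v u" for u
      using that
    proof (cases rule: edge_cases)
      case 3
      then show ?thesis by (auto simp: lateral_def side_step_def row_step_def)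
    qed (auto simp: heap_step_def)
    then have "card {u. E v u} \<le> card (set ?xs)" by (intro card_mono) auto
    also have "\<dots> \<le> 7" using card_length[of ?xs] by simp
    finally show "card {u. E v u} \<le> 7" .
  qed
  show "{..<n} \<subseteq> {..<n ^ c}" using assms by (cases "n = 0") (auto intro: less_le_trans self_le_power)
  show "\<forall>u w. E u w \<longrightarrow> lin u w \<in> lcl_Sin shortcut_lcl" by (simp add: heap_in_def)
qed simp

definition row_node :: "nat \<Rightarrow> nat \<Rightarrow> nat" where
  "row_node i j = 2 ^ (2 * s) + i + j * 2 ^ s"

lemma row_node_less:
  assumes "i < 2 ^ s" "j < 2 ^ s"
  shows "row_node i j < N"
proof -
  have "i + j * 2 ^ s < Suc j * 2 ^ s" using assms(1) by simp
  also have "\<dots> \<le> 2 ^ s * 2 ^ s" using assms(2) by (intro mult_le_mono1) simp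
  also have "\<dots> = 2 ^ (2 * s)" by (simp add: mult_2 power_add)
  finally show ?thesis by (simp add: row_node_def)
qed

lemma row_node_ge: "2 ^ (2 * s) \<le> row_node i j" and row_node_pos: "1 \<le> row_node i j"
  by (simp_all add: row_node_def Suc_le_eq)

lemma lev_row_node: "i < 2 ^ s \<Longrightarrow> j < 2 ^ s \<Longrightarrow> lev (row_node i j) = 2 * s"
  using row_node_less[of i j] row_node_ge[of i j] by (intro lev_eqI) auto

lemma row_node_step:
  assumes "i < 2 ^ s" "Suc j < 2 ^ s"
  shows "row_step s (row_node i j) (row_node i (Suc j))"
proof -
  have "2 * s - s = s" by simp
  then show ?thesis
    using assms s by (simp add: row_step_def lev_row_node) (simp add: row_node_def)
qed

text \<open>Label 2 is refuted by the absence of defects, then 3 by induction from the leaves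
  upwards and 4 by induction from the root downwards. What remains are bits, copied along the row
  from its start.\<close>

lemma heap_solution:
  assumes loc: "\<And>v. v < n \<Longrightarrow> loc_valid E lin lout v" and i: "i < 2 ^ s"
  shows "lout (row_node i (2 ^ s - 1)) (row_node i (2 ^ s - 1) div 2) = of_bool (i \<in> W)"
proof -
  \<comment> \<open>The half-edge to the heap parent exists at every node from 1 on, node 0 being
    the padding parent of the root, so it can represent the label of its node.\<close>
  define a where "a v = lout v (v div 2)" for v
  have a: "a v \<le> 4" "\<And>u. E v u \<Longrightarrow> lout v u = a v" "a v = 2 \<Longrightarrow> \<not> node_ok E lin v"
      "a v = 3 \<Longrightarrow> \<exists>u\<in>chi E lin v. a u \<in> {2,3}" "a v = 4 \<Longrightarrow> \<exists>u\<in>par E lin v. a u \<in> {2,3,4}"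
      "\<And>u. a v \<le> 1 \<Longrightarrow> u \<in> nxt E lin v \<Longrightarrow> a u = a v \<or> 2 \<le> a u"
      "\<And>u. a v \<le> 1 \<Longrightarrow> prv E lin v = {} \<Longrightarrow> u \<in> nxt E lin v \<Longrightarrow> lin v u = 3 + a v"
    if v: "1 \<le> v" "v < N" for v
  proof -
    have up: "E w (w div 2)" if "1 \<le> w" "w < n" for w using E_parent that by simp
    have out: "lout w u = a w" if "1 \<le> w" "w < n" "E w u" for w u
      using loc_validD(2)[OF loc up] that by (simp add: a_def)
    have vn: "v < n" using v n by simp
    note D = loc_validD[OF loc[OF vn] up[OF v(1) vn], folded a_def]
    have nbr: "lout u v = a u" if "1 \<le> u" "E v u" for u
      using out[OF that(1) _ E_sym[OF that(2)]] that(2) by (simp add: heap_edge_def)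
    have chi: "lout u v = a u" if "u \<in> chi E lin v" for u
      using chi_iff[OF v, of u] that v nbr[OF _ port_nbr[OF that]] by auto
    have par: "lout u v = a u" if "u \<in> par E lin v" for u
      using par_iff[OF v, of u] that v nbr[OF _ port_nbr[OF that]] by auto
    have nxt: "lout u v = a u" if "u \<in> nxt E lin v" for u
      using nxt_iff[OF v, of u] that row_step_gt[of s v u] nbr[OF _ port_nbr[OF that]] by auto
    show "a v \<le> 4" by (rule D(1))
    show "E v u \<Longrightarrow> lout v u = a v" for u by (rule D(2))
    show "a v = 2 \<Longrightarrow> \<not> node_ok E lin v" by (rule D(3))
    show "a v = 3 \<Longrightarrow> \<exists>u\<in>chi E lin v. a u \<in> {2,3}" using D(4) chi by fastforce
    show "a v = 4 \<Longrightarrow> \<exists>u\<in>par E lin v. a u \<in> {2,3,4}" using D(5) par by fastforce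
    show "a v \<le> 1 \<Longrightarrow> u \<in> nxt E lin v \<Longrightarrow> a u = a v \<or> 2 \<le> a u" for u using D(6)[of u] nxt[of u] by simp
    show "a v \<le> 1 \<Longrightarrow> prv E lin v = {} \<Longrightarrow> u \<in> nxt E lin v \<Longrightarrow> lin v u = 3 + a v" for u
      by (rule D(7))
  qed
  have not2: "a x \<noteq> 2" if "1 \<le> x" "x < N" for x
    using a(3) heap_node_ok that by blast
  have not3: "a x \<noteq> 3" if "1 \<le> x" "x < N" for x
    using that
  proof (induction "2 * s - lev x" arbitrary: x rule: less_induct)
    case less
    show ?case
    proof
      assume "a x = 3"
      then obtain u where u: "u \<in> chi E lin x" "a u \<in> {2,3}" using a(4) less.prems by blast
      have u': "lev x < 2 * s" "u \<in> {2 * x, Suc (2 * x)}" using u(1) chi_iff[OF less.prems] by auto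
      then have lev: "lev u = Suc (lev x)" using lev_double less.prems by auto
      have tree: "1 \<le> u" "u < N" using u' lev less.prems tree_lev[of u] by auto
      have "a u \<noteq> 3" using less.hyps[OF _ tree] lev u'(1) by auto
      then show False using u(2) not2[OF tree] by auto
    qed
  qed
  have not4: "a x \<noteq> 4" if "1 \<le> x" "x < N" for x
    using that
  proof (induction x rule: less_induct)
    case (less x)
    show ?case
    proof
      assume "a x = 4"
      then obtain u where u: "u \<in> par E lin x" "a u \<in> {2,3,4}" using a(5) less.prems by blast
      have u': "2 \<le> x" "u = x div 2" using u(1) par_iff[OF less.prems] by auto
      then have tree: "1 \<le> u" "u < N" "u < x" using less.prems by auto
      then show False using u(2) not2[OF tree(1,2)] not3[OF tree(1,2)] less.IH[OF tree(3,1,2)] by auto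
    qed
  qed
  have bit: "a x \<le> 1" if "1 \<le> x" "x < N" for x
  proof -
    have "a x \<in> {0,1,2,3,4}" using a(1)[OF that] by auto
    then show ?thesis using not2[OF that] not3[OF that] not4[OF that] by auto
  qed
  have tree: "1 \<le> row_node i j" "row_node i j < N" if "j < 2 ^ s" for j
    using row_node_pos row_node_less[OF i that] by auto
  have one: "1 < (2::nat) ^ s" using s by (intro one_less_power) auto
  have row: "a (row_node i j) = a (row_node i 0)" if "j < 2 ^ s" for j
    using that
  proof (induction j)
    case (Suc j)
    then have j: "j < 2 ^ s" by simp
    have "row_node i (Suc j) \<in> nxt E lin (row_node i j)"
      using row_node_step[OF i Suc.prems] nxt_iff[OF tree[OF j]] by blast
    then have "a (row_node i (Suc j)) = a (row_node i j)"
      using a(6)[OF tree[OF j] bit[OF tree[OF j]]] bit[OF tree[OF Suc.prems]] by fastforce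
    then show ?case using Suc.IH j by simp
  qed simp
  have start: "lin (row_node i 0) (row_node i 1) = 3 + a (row_node i 0)"
  proof (rule a(7))
    show "1 \<le> row_node i 0" "row_node i 0 < N" "a (row_node i 0) \<le> 1" using tree bit by simp_all
    show "row_node i 1 \<in> nxt E lin (row_node i 0)"
      using row_node_step[OF i, of 0] nxt_iff[OF tree[of 0]] one by simp
    \<comment> \<open>A predecessor would lie 2^s places to the left, hence below 2^(2s) and not on
      the leaf level.\<close>
    have "\<not> row_step s z (row_node i 0)" for z
    proof
      assume row: "row_step s z (row_node i 0)"
      then have z: "lev z = 2 * s" "row_node i 0 = z + 2 ^ s"
        using lev_row_node[OF i, of 0] by (auto simp: row_step_def)
      then have "z < 2 ^ (2 * s)" using i by (simp add: row_node_def)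
      then show False using z(1) lev_bounds(1)[of z] row_step_gt[OF row] by auto
    qed
    then show "prv E lin (row_node i 0) = {}" using prv_iff[OF tree[of 0]] by auto
  qed
  have row01: "row_step s (row_node i 0) (row_node i 1)"
    using row_node_step[OF i, of 0] one by simp
  have "lev (row_node i 0) = 2 * s" "row_node i 0 - 2 ^ (2 * s) = i"
    using lev_row_node[OF i, of 0] by (simp_all add: row_node_def)
  then have "lin (row_node i 0) (row_node i 1) = 3 + of_bool (i \<in> W)"
    using row01 by (subst heap_in_lateral) (simp_all add: lateral_def)
  then have "a (row_node i 0) = of_bool (i \<in> W)" using start by simp
  then show ?thesis using row[of "2 ^ s - 1"] by (simp add: a_def)
qed

end

section \<open>The CONGEST lower bound\<close>

text \<open>The subtree of \<open>x\<close> meets a column from \<open>c\<close> on. Columns are identified with the nodes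
  \<open>2 ^ s, \<dots>, 2 ^ Suc s - 1\<close> of level \<open>s\<close>.\<close>

definition right_of :: "nat \<Rightarrow> nat \<Rightarrow> nat \<Rightarrow> bool" where
  "right_of s c x \<longleftrightarrow> x = 0 \<or> (if lev x \<le> s then c < Suc x * 2 ^ (s - lev x)
     else c \<le> x div 2 ^ (lev x - s))"

text \<open>The ancestor of column \<open>Suc c\<close> at level \<open>d\<close>. When the cut moves from \<open>c\<close> to \<open>Suc c\<close>, all
  messages into the remaining part come from left neighbours of these ancestors.\<close>

definition cut_node :: "nat \<Rightarrow> nat \<Rightarrow> nat \<Rightarrow> nat" where
  "cut_node s c d = Suc c div 2 ^ (s - d)"

text \<open>Here \<open>y\<close> sends and \<open>x\<close> receives. Each of the \<open>s\<close>
  levels has one sender and two receivers, its right neighbour and its parent, which gives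
  \<open>2 * s\<close> messages per round.\<close>

definition on_cut :: "nat \<Rightarrow> nat \<Rightarrow> nat \<Rightarrow> nat \<Rightarrow> bool" where
  "on_cut s c y x \<longleftrightarrow> (\<exists>d\<in>{1..s}. y = cut_node s c d - 1 \<and> (x = cut_node s c d \<or> x = y div 2))"

section \<open>The moving cut\<close>

lemma right_of_anti: "right_of s (Suc c) x \<Longrightarrow> right_of s c x"
  by (auto simp: right_of_def split: if_splits)

lemma cut_nodeI:
  assumes "Suc x * 2 ^ (s - d) \<le> c" "Suc c < Suc (Suc x) * 2 ^ (s - d)"
  shows "cut_node s c d = Suc x"
  unfolding cut_node_def using assms by (intro div_nat_eqI) (simp_all add: mult.commute)

lemma right_of_heap_parent:
  assumes "right_of s (Suc c) x" "heap_step y x"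
  shows "right_of s c y"
proof (cases "y = 0")
  case False
  have x: "2 \<le> x" "y = x div 2" "lev y = lev x - 1"
    using assms(2) False by (auto simp: heap_step_def)
  have lev: "1 \<le> lev x" using x(1) by (rule lev_pos)
  show ?thesis
  proof (cases "lev x \<le> s")
    case True
    have "c < Suc x * 2 ^ (s - lev x)" using assms(1) x True by (simp add: right_of_def)
    also have "\<dots> \<le> (2 * Suc y) * 2 ^ (s - lev x)" using x by (intro mult_le_mono1) simp
    also have "\<dots> = Suc y * 2 ^ (s - lev y)"
      using x lev True by (simp add: Suc_diff_le[symmetric] flip: power_Suc)
    finally show ?thesis using x True by (simp add: right_of_def)
  next
    case False
    then obtain k where k: "lev x - s = Suc k" by (metis Suc_diff_Suc not_le)
    have "Suc c \<le> x div 2 ^ Suc k" using assms(1) x False k by (simp add: right_of_def)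
    then have c: "Suc c \<le> y div 2 ^ k" using x by (simp add: div_mult2_eq)
    show ?thesis
    proof (cases k)
      case 0
      then have "lev y = s" using x k by simp
      then show ?thesis using c 0 by (simp add: right_of_def)
    next
      case (Suc k')
      then have "s < lev y" "lev y - s = k" using x k by simp_all
      then show ?thesis using c by (simp add: right_of_def)
    qed
  qed
qed (simp add: right_of_def)

text \<open>From the column roots down a child stays in the column. Above them a right child ends at
  the same column as its parent, so only a left child can fall behind the cut, and then its right
  sibling is the cut node.\<close>

lemma right_of_heap_child:
  assumes x: "right_of s (Suc c) x" and step: "heap_step x y" and c: "Suc c < 2 ^ Suc s"
  shows "right_of s c y \<or> on_cut s c y x"
proof (cases "x = 0")
  case True
  then have "y = 1" using step by (auto simp: heap_step_def)
  then show ?thesis using c by (simp add: right_of_def)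
next
  case False
  then have y: "y = 2 * x \<or> y = Suc (2 * x)" "x = y div 2" "y \<noteq> 0" using step by (auto simp: heap_step_def)
  have lev: "lev y = Suc (lev x)" using y(1) lev_double False by auto
  show ?thesis
  proof (cases "lev x < s")
    case True
    then obtain e where e: "s - lev x = Suc e" by (metis Suc_diff_Suc)
    then have e': "s - lev y = e" using lev by simp
    have cx: "Suc c < Suc x * 2 ^ Suc e" using x True e False by (simp add: right_of_def)
    show ?thesis
    proof (cases "c < Suc y * 2 ^ e")
      case True
      then show ?thesis using e' \<open>lev x < s\<close> lev by (simp add: right_of_def)
    next
      case False
      have "y \<noteq> Suc (2 * x)"
      proof
        assume "y = Suc (2 * x)"
        then have "Suc y * 2 ^ e = Suc x * 2 ^ Suc e" by simp
        then show False using False cx by simp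
      qed
      then have "Suc (Suc y) * 2 ^ e = Suc x * 2 ^ Suc e" using y(1) by simp
      then have "Suc c < Suc (Suc y) * 2 ^ (s - lev y)" unfolding e' using cx by (simp only:)
      moreover have "Suc y * 2 ^ (s - lev y) \<le> c" unfolding e' using False by (simp only: not_less)
      ultimately have "cut_node s c (lev y) = Suc y" by (intro cut_nodeI)
      moreover have "1 \<le> lev y" "lev y \<le> s" using lev \<open>lev x < s\<close> by simp_all
      ultimately have "on_cut s c y x"
        unfolding on_cut_def by (intro bexI[of _ "lev y"] conjI disjI2 y(2)) simp_all
      then show ?thesis ..
    qed
  next
    case False
    then obtain k where k: "lev y - s = Suc k" using lev by (metis Suc_diff_le not_less)
    have "c \<le> x div 2 ^ k"
    proof (cases k)
      case 0
      then have "lev x = s" using k lev by simp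
      then show ?thesis using x 0 \<open>x \<noteq> 0\<close> by (simp add: right_of_def)
    next
      case (Suc k')
      then have "s < lev x" "lev x - s = k" using k lev by simp_all
      then show ?thesis using x \<open>x \<noteq> 0\<close> by (simp add: right_of_def)
    qed
    then have "c \<le> y div 2 ^ Suc k" using y(2) by (simp add: div_mult2_eq)
    then show ?thesis using k lev False by (simp add: right_of_def)
  qed
qed

text \<open>Below the column roots a lateral step changes the column by at most one, paid for by the
  move of the cut. In the tree over the columns only a step to the left can leave the region, and
  then it starts at the cut node.\<close>

lemma right_of_lateral:
  assumes x: "right_of s (Suc c) x" and lat: "lateral s x y"
  shows "right_of s c y \<or> on_cut s c y x"
proof -
  have lev: "lev y = lev x" "x \<noteq> 0" "y \<noteq> 0" using lateral_lev[OF lat] by auto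
  let ?k = "lev x - s"
  have up: "right_of s c y" if "x \<le> y"
  proof (cases "lev x \<le> s")
    case True
    have "c < Suc x * 2 ^ (s - lev x)" using x True lev by (simp add: right_of_def)
    also have "\<dots> \<le> Suc y * 2 ^ (s - lev x)" using that by (intro mult_le_mono1) simp
    finally show ?thesis using lev True by (simp add: right_of_def)
  next
    case False
    have "c \<le> x div 2 ^ ?k" using x False lev by (simp add: right_of_def)
    also have "\<dots> \<le> y div 2 ^ ?k" using that by (rule div_le_mono)
    finally show ?thesis using lev False by (simp add: right_of_def)
  qed
  have near: "right_of s c y" if "s < lev x" "x \<le> y + 2 ^ ?k"
  proof -
    have "Suc c \<le> x div 2 ^ ?k" using x that lev by (simp add: right_of_def)
    also have "\<dots> \<le> (y + 2 ^ ?k) div 2 ^ ?k" using that by (intro div_le_mono)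
    also have "\<dots> = Suc (y div 2 ^ ?k)" by simp
    finally show ?thesis using lev that by (simp add: right_of_def)
  qed
  from lat consider "x \<le> y" | "side_step y x" | "row_step s y x"
    by (auto simp: lateral_def side_step_def row_step_def)
  then show ?thesis
  proof cases
    case 2
    then have xy: "x = Suc y" by (simp add: side_step_def)
    show ?thesis
    proof (cases "lev x \<le> s")
      case True
      show ?thesis
      proof (cases "c < Suc y * 2 ^ (s - lev x)")
        case False
        have "cut_node s c (lev x) = Suc y"
          using False x xy True lev by (intro cut_nodeI) (auto simp: right_of_def)
        then have "on_cut s c y x"
          unfolding on_cut_def using xy True lev_pos[OF lateral_two_le[OF lat]]
          by (intro bexI[of _ "lev x"]) auto
        then show ?thesis ..
      qed (use lev True in \<open>simp add: right_of_def\<close>)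
    next
      case False
      then show ?thesis using near xy by simp
    qed
  next
    case 3
    then show ?thesis using near lev by (simp add: row_step_def)
  qed (simp add: up)
qed

lemma right_of_edge:
  assumes "right_of s (Suc c) x" "heap_edge s n x y" "Suc c < 2 ^ Suc s"
  shows "right_of s c y \<or> on_cut s c y x"
proof -
  from assms(2) consider "heap_step x y" | "heap_step y x" | "lateral s x y"
    by (auto simp: heap_edge_def)
  then show ?thesis
    using right_of_heap_parent[OF assms(1)] right_of_heap_child[OF assms(1) _ assms(3)]
      right_of_lateral[OF assms(1)] by cases blast+
qed

text \<open>The cut begins at \<open>Suc (2 ^ s)\<close>, just right of the first column, where all
  input bits sit, and has moved by \<open>t\<close> columns after \<open>t\<close> rounds. The index
  gives the round, the level and the choice between the two receivers.\<close>

definition transcript ::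
  "alg \<Rightarrow> nat \<Rightarrow> nat \<Rightarrow> (nat \<Rightarrow> bool list) \<Rightarrow> nat set \<Rightarrow> nat \<times> nat \<times> bool \<Rightarrow> bool list" where
  "transcript A s n \<rho> W = (\<lambda>(t, d, b).
     let x = cut_node s (Suc (2 ^ s + t)) d; y = x - 1
     in a_send A n (run A n (heap_edge s n) (heap_in s W) \<rho> t y) (if b then x else y div 2))"

lemma heap_in_right_of:
  assumes s: "1 \<le> s" and W: "W \<subseteq> {..<2 ^ s}" and x: "right_of s (Suc (2 ^ s)) x"
  shows "heap_in s W x u = heap_in s {} x u"
proof -
  have "x - 2 ^ (2 * s) \<notin> W" if lev: "lev x = 2 * s"
  proof
    assume "x - 2 ^ (2 * s) \<in> W"
    then have "x < 2 ^ (2 * s) + 2 ^ s" using W by auto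
    also have "\<dots> = Suc (2 ^ s) * 2 ^ s" by (simp add: mult_2 power_add)
    finally have "x div 2 ^ s < Suc (2 ^ s)" by (simp add: less_mult_imp_div_less)
    moreover have "x \<noteq> 0" using lev s by (auto intro: ccontr)
    ultimately show False using x lev s by (simp add: right_of_def)
  qed
  then show ?thesis by (auto simp: heap_in_def)
qed

text \<open>By induction on time, with the random strings fixed: a node right of the cut after a
  round was already right of the old cut, and so was every neighbour whose message is not in the
  transcript.\<close>

lemma run_right_of:
  assumes s: "1 \<le> s" and W: "W \<subseteq> {..<2 ^ s}" "W' \<subseteq> {..<2 ^ s}" and T: "T + 2 \<le> 2 ^ s"
    and eq: "\<And>t d b. t < T \<Longrightarrow> d \<in> {1..s} \<Longrightarrow> transcript A s n \<rho> W (t, d, b) = transcript A s n \<rho> W' (t, d, b)"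
    and t: "t \<le> T" and x: "right_of s (Suc (2 ^ s + t)) x"
  shows "run A n (heap_edge s n) (heap_in s W) \<rho> t x = run A n (heap_edge s n) (heap_in s W') \<rho> t x"
  using t x
proof (induction t arbitrary: x)
  case 0
  have "heap_in s W x u = heap_in s W' x u" for u
    using heap_in_right_of[OF s W(1)] heap_in_right_of[OF s W(2)] 0 by simp
  then show ?case by (simp add: fun_eq_iff cong: if_cong)
next
  case (Suc t)
  let ?run = "\<lambda>W. run A n (heap_edge s n) (heap_in s W) \<rho> t" and ?c = "Suc (2 ^ s + t)"
  have x: "right_of s (Suc ?c) x" using Suc.prems by simp
  have IH: "?run W y = ?run W' y" if "right_of s ?c y" for y using Suc that by simp
  have msg: "a_send A n (?run W u) x = a_send A n (?run W' u) x" if xu: "heap_edge s n x u" for u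
  proof -
    have "Suc ?c < 2 ^ Suc s" using T Suc.prems by simp
    then consider "right_of s ?c u" | "on_cut s ?c u x" using right_of_edge[OF x xu] by blast
    then show ?thesis
    proof cases
      case 2
      then obtain d b where "d \<in> {1..s}" "u = cut_node s ?c d - 1"
        "x = (if b then cut_node s ?c d else u div 2)"
        unfolding on_cut_def by metis
      then show ?thesis
        using eq[of t d b] Suc.prems(1) by (cases b) (simp_all add: transcript_def Let_def)
    qed (simp add: IH)
  qed
  have "(\<lambda>u. if heap_edge s n x u then Some (a_send A n (?run W u) x) else None) =
      (\<lambda>u. if heap_edge s n x u then Some (a_send A n (?run W' u) x) else None)"
    using msg by (auto simp: fun_eq_iff)
  then show ?case using IH[OF right_of_anti[OF x]] by simp
qed

section \<open>Counting transcripts\<close>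

lemma card_bool_lists_le: "card {xs :: bool list. length xs \<le> B} \<le> 2 ^ Suc B"
  and finite_bool_lists_le: "finite {xs :: bool list. length xs \<le> B}"
proof -
  have "card {xs :: bool list. length xs \<le> B} = (\<Sum>i\<le>B. 2 ^ i)"
    using card_lists_length_le[of "UNIV :: bool set" B] by simp
  also have "\<dots> \<le> 2 ^ Suc B" by (simp add: sum_power2 atMost_atLeast0 atLeastLessThanSuc_atLeastAtMost[symmetric])
  finally show "card {xs :: bool list. length xs \<le> B} \<le> 2 ^ Suc B" .
  show "finite {xs :: bool list. length xs \<le> B}"
    using finite_lists_length_le[of "UNIV :: bool set" B] by simp
qed

text \<open>For fixed \<open>\<rho>\<close> the transcript determines the states at the right ends
  of all rows; a correct run outputs \<open>W\<close> there, so distinct solved \<open>W\<close>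
  have distinct transcripts.\<close>

lemma card_solved_le:
  assumes s: "1 \<le> s" and n: "2 ^ (2 * s + 1) \<le> n" and T: "T + 2 \<le> 2 ^ s"
    and B: "\<And>st u. length (a_send A n st u) \<le> B"
  shows "card {W \<in> Pow {..<2 ^ s}. lcl_valid shortcut_lcl {..<n} (heap_edge s n) (heap_in s W)
      (alg_output A n (heap_edge s n) (heap_in s W) \<rho> T)} \<le> 2 ^ (Suc B * (2 * s * T))"
    (is "card ?S \<le> _")
proof -
  define I where "I = {..<T} \<times> {1..s} \<times> (UNIV :: bool set)"
  define F where "F W = restrict (transcript A s n \<rho> W) I" for W
  let ?P = "PiE I (\<lambda>_. {xs :: bool list. length xs \<le> B})"
  have last: "i \<in> W \<longleftrightarrow> alg_output A n (heap_edge s n) (heap_in s W) \<rho> T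
      (heap_graph.row_node s i (2 ^ s - 1)) (heap_graph.row_node s i (2 ^ s - 1) div 2) = 1"
    if W: "W \<in> ?S" and i: "i < 2 ^ s" for W i
  proof -
    interpret heap_graph s n W by unfold_locales (fact s, fact n)
    have "loc_valid E lin (alg_output A n E lin \<rho> T) v" if "v < n" for v
      using W that shortcut_lcl_valid_iff[OF heap_instance[of 1]] by simp
    from heap_solution[OF this i] show ?thesis by simp
  qed
  have "inj_on F ?S"
  proof (rule inj_onI)
    fix W W' assume W: "W \<in> ?S" and W': "W' \<in> ?S" and eq: "F W = F W'"
    have tr: "transcript A s n \<rho> W (t, d, b) = transcript A s n \<rho> W' (t, d, b)"
      if "t < T" "d \<in> {1..s}" for t d b
      using fun_cong[OF eq, of "(t, d, b)"] that by (simp add: F_def I_def)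
    have "i \<in> W \<longleftrightarrow> i \<in> W'" if i: "i < 2 ^ s" for i
    proof -
      interpret heap_graph s n W by unfold_locales (fact s, fact n)
      let ?x = "row_node i (2 ^ s - 1)"
      have "(2::nat) ^ (2 * s) = 2 ^ s * 2 ^ s" by (simp add: mult_2 power_add)
      then have "?x = (2 ^ s + (2 ^ s - 1)) * 2 ^ s + i"
        unfolding row_node_def by (simp only: add_mult_distrib add_mult_distrib2 ac_simps)
      then have "?x div 2 ^ s = 2 ^ s + (2 ^ s - 1)" using i by (simp add: div_mult_self3)
      moreover have "lev ?x = 2 * s" using i by (intro lev_row_node) simp_all
      \<comment> \<open>The last column has number 2^(s+1) - 1 and must still be right of the cut
        after \<open>T\<close> rounds; this is the source of
        \<open>T + 2 \<le> 2 ^ s\<close>.\<close>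
      moreover have "Suc (2 ^ s + T) \<le> 2 ^ s + (2 ^ s - 1)" using T by linarith
      ultimately have "right_of s (Suc (2 ^ s + T)) ?x"
        using s by (simp add: right_of_def)
      then have "run A n (heap_edge s n) (heap_in s W) \<rho> T ?x = run A n (heap_edge s n) (heap_in s W') \<rho> T ?x"
        using W W' by (intro run_right_of[OF s _ _ T tr]) auto
      then show ?thesis using last[OF W i] last[OF W' i] by (simp add: alg_output_def)
    qed
    then show "W = W'" using W W' by blast
  qed
  moreover have "F ` ?S \<subseteq> ?P"
    using B by (auto simp: F_def transcript_def Let_def)
  moreover have "finite ?P"
    by (intro finite_PiE) (auto simp: I_def finite_bool_lists_le)
  ultimately have "card ?S \<le> card ?P" by (rule card_inj_on_le)
  also have "\<dots> = card {xs :: bool list. length xs \<le> B} ^ card I"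
    by (subst card_PiE) (auto simp: I_def)
  also have "\<dots> \<le> (2 ^ Suc B) ^ card I"
    by (intro power_mono card_bool_lists_le) simp
  also have "card I = 2 * s * T" by (simp add: I_def card_cartesian_product card_UNIV_bool)
  also have "(2 ^ Suc B) ^ (2 * s * T) = (2::nat) ^ (Suc B * (2 * s * T))" by (rule power_mult[symmetric])
  finally show ?thesis .
qed

text \<open>Double counting of pairs of a bit set and random strings: each set is solved by at least
  half of the strings, since n \<ge> 2, and each choice of strings solves at most one set per
  transcript. Comparing exponents gives the bound; with 2^s - 1 or more rounds it is
  immediate.\<close>

lemma rand_solves_rounds:
  assumes s: "1 \<le> s" and n: "2 ^ (2 * s + 1) \<le> n" and c: "1 \<le> c"
    and B: "\<And>st u. length (a_send A n st u) \<le> B"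
    and solves: "rand_solves shortcut_lcl 7 c A T"
  shows "2 ^ s - 1 \<le> 2 * s * T n * Suc B"
proof (cases "T n + 2 \<le> 2 ^ s")
  case False
  then have "2 ^ s - 1 \<le> T n * 1" by simp
  also have "\<dots> \<le> T n * (2 * s * Suc B)" using s by (intro mult_le_mono2) simp
  finally show ?thesis by (simp add: algebra_simps)
next
  case True
  define S where "S = PiE {..<n} (\<lambda>_. {xs :: bool list. length xs = a_bits A n})"
  define good where "good W \<rho> \<longleftrightarrow> lcl_valid shortcut_lcl {..<n} (heap_edge s n) (heap_in s W)
      (alg_output A n (heap_edge s n) (heap_in s W) \<rho> (T n))" for W \<rho>
  have "finite {xs :: bool list. length xs = a_bits A n}"
    using finite_lists_length_eq[of "UNIV :: bool set"] by simp
  then have S: "finite S" by (auto simp: S_def intro: finite_PiE)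
  have "replicate (a_bits A n) True \<in> {xs :: bool list. length xs = a_bits A n}" by simp
  then have S_ne: "S \<noteq> {}" unfolding S_def PiE_eq_empty_iff by blast
  have n2: "2 \<le> n" using n by (rule order_trans[rotated]) (simp add: self_le_power)
  have half: "real (card S) / 2 \<le> real (card {\<rho> \<in> S. good W \<rho>})" for W
  proof -
    interpret heap_graph s n W by unfold_locales (fact s, fact n)
    have "1 - 1 / real n \<le> measure_pmf.prob (rand_bits {..<n} (a_bits A n)) {\<rho>. good W \<rho>}"
      using solves heap_instance[OF c] unfolding rand_solves_def good_def by blast
    also have "\<dots> = real (card (S \<inter> {\<rho>. good W \<rho>})) / real (card S)"
      unfolding rand_bits_def S_def[symmetric] by (rule measure_pmf_of_set[OF S_ne S])
    finally have "1 - 1 / real n \<le> real (card {\<rho> \<in> S. good W \<rho>}) / real (card S)"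
      by (simp add: Int_def conj_commute)
    moreover have "1 / 2 \<le> 1 - 1 / real n" using n2 by (simp add: field_simps)
    ultimately have "1 / 2 \<le> real (card {\<rho> \<in> S. good W \<rho>}) / real (card S)" by linarith
    moreover have "0 < card S" using S S_ne by (simp add: card_gt_0_iff)
    ultimately show ?thesis by (simp add: field_simps)
  qed
  let ?Q = "(2::nat) ^ (Suc B * (2 * s * T n))"
  have "2 ^ 2 ^ s * (real (card S) / 2) = (\<Sum>W\<in>Pow {..<2 ^ s :: nat}. real (card S) / 2)"
    by (simp add: card_Pow)
  also have "\<dots> \<le> (\<Sum>W\<in>Pow {..<2 ^ s}. real (card {\<rho> \<in> S. good W \<rho>}))"
    by (intro sum_mono half)
  also have "\<dots> = real (\<Sum>W\<in>Pow {..<2 ^ s}. card {\<rho> \<in> S. good W \<rho>})" by simp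
  also have "(\<Sum>W\<in>Pow {..<2 ^ s}. card {\<rho> \<in> S. good W \<rho>}) =
      (\<Sum>\<rho>\<in>S. card {W \<in> Pow {..<2 ^ s}. good W \<rho>})"
    using S by (intro sum_multicount_gen) auto
  also have "real \<dots> \<le> real (card S * ?Q)"
    unfolding of_nat_le_iff
  proof (rule sum_bounded_above[where 'a = nat, unfolded of_nat_id])
    fix \<rho> assume "\<rho> \<in> S"
    show "card {W \<in> Pow {..<2 ^ s}. good W \<rho>} \<le> ?Q"
      unfolding good_def by (rule card_solved_le[OF s n True B])
  qed
  finally have "2 ^ 2 ^ s * (real (card S) / 2) \<le> real (card S) * real ?Q" by simp
  then have "(2::real) ^ 2 ^ s \<le> 2 * real ?Q"
    using S S_ne by (simp add: field_simps card_gt_0_iff)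
  then have "(2::real) ^ 2 ^ s \<le> 2 ^ Suc (Suc B * (2 * s * T n))" by simp
  then have "2 ^ s \<le> Suc (Suc B * (2 * s * T n))" by (subst (asm) power_increasing_iff) simp_all
  then show ?thesis by (simp add: algebra_simps)
qed

lemma congest_rounds_bigomega:
  assumes A: "congest_alg \<beta> A" and \<beta>: "1 \<le> \<beta>" and c: "1 \<le> c"
    and solves: "rand_solves shortcut_lcl 7 c A T"
  shows "(\<lambda>n. real (T n)) \<in> \<Omega>(\<lambda>n. sqrt (real n) / (ln (real n))\<^sup>2)"
\<comment> \<open>The factor 24 is 6 times 4: sqrt n / 6 \<le> 2^s - 1, and 2s(B + 1) \<le>
  4\<beta>L^2 for L = log 2 n, from s \<le> L and B + 1 \<le> 2\<beta>L. The square of ln 2 converts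
  L to ln n.\<close>
proof (rule landau_omega.bigI[where c = "(ln 2)\<^sup>2 / (24 * real \<beta>)"])
  show "0 < (ln 2)\<^sup>2 / (24 * real \<beta>)" using \<beta> by simp
  show "\<forall>\<^sub>F n in at_top. (ln 2)\<^sup>2 / (24 * real \<beta>) * norm (sqrt (real n) / (ln (real n))\<^sup>2)
      \<le> norm (real (T n))"
    using eventually_ge_at_top[of 8]
  proof eventually_elim
    case (elim n)
    \<comment> \<open>The largest \<open>s\<close> for which the tree fits into n nodes. Then n < 8
      * 4^s, which is at most the square of 3 * 2^s; n \<ge> 8 ensures s \<ge> 1.\<close>
    define s where "s = (lev n - 1) div 2"
    define L where "L = log 2 (real n)"
    define B where "B = \<beta> * (nat \<lceil>L\<rceil> + 1)"
    have lev: "3 \<le> lev n" using elim floor_log_le_iff[of 8 n] floor_log_power[of 3] by simp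
    then have s: "1 \<le> s" "2 * s + 1 \<le> lev n" "lev n \<le> 2 * s + 2" by (auto simp: s_def)
    have n_ge: "2 ^ (2 * s + 1) \<le> n"
      using power_increasing[OF s(2), of "2::nat"] lev_bounds(1)[of n] elim by simp
    have "n < 2 * 2 ^ lev n" by (rule lev_bounds(2))
    also have "\<dots> \<le> 2 * 2 ^ (2 * s + 2)" using s(3) by (intro mult_le_mono2 power_increasing) auto
    finally have "real n < real (2 * 2 ^ (2 * s + 2))" by (simp only: of_nat_less_iff)
    also have "\<dots> \<le> (3 * 2 ^ s)\<^sup>2" by (simp add: power_mult_distrib power_mult power_add power2_eq_square flip: power_mult_distrib)
    finally have "sqrt (real n) \<le> 3 * 2 ^ s"
      by (intro real_le_lsqrt) auto
    moreover have "(2::real) \<le> 2 ^ s" using power_increasing[OF s(1), of "2::real"] by simp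
    ultimately have sq: "sqrt (real n) / 6 \<le> 2 ^ s - 1" by simp
    have L: "3 \<le> L" using elim le_log_iff[of 2 n 3] by (simp add: L_def)
    have "2 ^ s \<le> n" using n_ge power_increasing[of s "2 * s + 1" "2::nat"] by simp
    then have "real (2 ^ s) \<le> real n" by (simp only: of_nat_le_iff)
    then have sL: "real s \<le> L" using elim le_log_iff[of 2 n s] by (simp add: L_def powr_realpow)
    have "real (nat \<lceil>L\<rceil>) \<le> L + 1" using L by linarith
    then have "real B \<le> real \<beta> * (L + 2)"
      unfolding B_def of_nat_mult by (intro mult_left_mono) auto
    then have "real (Suc B) \<le> real \<beta> * (L + 2) + 1" by simp
    also have "\<dots> \<le> real \<beta> * (L + 2) + real \<beta> * 1" using \<beta> by simp
    also have "\<dots> = real \<beta> * (L + 3)" by (simp add: algebra_simps)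
    also have "\<dots> \<le> real \<beta> * (2 * L)" using L by (intro mult_left_mono) auto
    finally have BL: "real (Suc B) \<le> real \<beta> * (2 * L)" .
    have "2 ^ s - 1 \<le> 2 * s * T n * Suc B"
      using A by (intro rand_solves_rounds[OF s(1) n_ge c _ solves]) (simp add: congest_alg_def B_def L_def)
    then have "real (2 ^ s - 1) \<le> real (2 * s * T n * Suc B)" by (simp only: of_nat_le_iff)
    then have "2 ^ s - 1 \<le> 2 * real (T n) * (real s * real (Suc B))" by (simp add: algebra_simps of_nat_diff)
    also have "\<dots> \<le> 2 * real (T n) * (L * (real \<beta> * (2 * L)))"
      using sL BL L by (intro mult_left_mono mult_mono) auto
    finally have "sqrt (real n) / 6 \<le> 4 * real \<beta> * L\<^sup>2 * real (T n)"
      using sq by (simp add: power2_eq_square algebra_simps)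
    then have "sqrt (real n) / (24 * real \<beta> * L\<^sup>2) \<le> real (T n)"
      using \<beta> L by (simp add: field_simps)
    moreover have "L\<^sup>2 = (ln (real n))\<^sup>2 / (ln 2)\<^sup>2" by (simp add: L_def log_def power_divide)
    ultimately show ?case by (simp add: field_simps)
  qed
qed

theorem theorem6p1:
  shows "\<exists>P \<Delta>. is_lcl P \<and>
    (\<forall>c \<ge> 1. \<exists>A T. det_solves P \<Delta> c A T \<and>
        (\<lambda>n. real (T n)) \<in> O(\<lambda>n. ln (real n))) \<and>
    (\<forall>c \<ge> 1. \<forall>\<beta> \<ge> 1. \<forall>A T. congest_alg \<beta> A \<and> rand_solves P \<Delta> c A T \<longrightarrow>
        (\<lambda>n. real (T n)) \<in> \<Omega>(\<lambda>n. sqrt (real n) / (ln (real n))\<^sup>2))"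
  using is_lcl_shortcut det_solves_shortcut floorlog_bigo congest_rounds_bigomega
  by (intro exI[of _ shortcut_lcl] exI[of _ 7]) blast

end
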